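(* As $\beta \rightarrow \infty$, $Q_1(\infty) + \beta$ converges weakly to the standard normal distribution.
   Context: For $\beta>0$, consider the diffusion process $(Q_1,Q_2)$ with state space $(-\infty,0]\times(0,\infty)$ given, for $t\ge 0$, by $$Q_1(t) = Q_1(0) + \sqrt{2}\, W(t) - \beta t + \int_0^t (- Q_1(s) + Q_2(s))\, ds - L(t),\qquad Q_2(t) = Q_2(0) + L(t) - \int_0^t Q_2(s)\,ds,$$ where $W$ is a standard Brownian motion and $L$ is the unique nondecreasing nonnegative process in $D_{\mathbb{R}}[0,\infty)$ keeping $Q_1\le 0$ and satisfying $\int_0^\infty \mathbf{1}_{[Q_1(t)<0]}\,dL(t)=0$. For each $\beta>0$ this is an ergodic Markov process with a unique stationary distribution $\pi$ (depending on $\beta$); $(Q_1(\infty),Q_2(\infty))$ denotes a random variable with law $\pi$. *)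

theory Defs
  imports "HOL-Probability.Probability"
begin

text \<open>
  Processes are indexed by \<^typ>\<open>real\<close>, but only times \<open>t \<ge> 0\<close> matter; values at negative
  times are arbitrary.
\<close>

definition cadlag :: "(real \<Rightarrow> real) \<Rightarrow> bool" where
  "cadlag f \<longleftrightarrow>
     (\<forall>t\<ge>0. (f \<longlongrightarrow> f t) (at_right t)) \<and> (\<forall>t>0. \<exists>l. (f \<longlongrightarrow> l) (at_left t))"

locale brownian_motion = prob_space M
  for M :: "'a measure" and W :: "real \<Rightarrow> 'a \<Rightarrow> real" +
  assumes W_measurable: "\<And>t. 0 \<le> t \<Longrightarrow> W t \<in> borel_measurable M"
    and W_start: "AE \<omega> in M. W 0 \<omega> = 0"
    and W_continuous: "AE \<omega> in M. continuous_on {0..} (\<lambda>t. W t \<omega>)"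
    and W_gaussian_increments: "\<And>s t. 0 \<le> s \<Longrightarrow> s < t \<Longrightarrow>
          distributed M lborel (\<lambda>\<omega>. W t \<omega> - W s \<omega>) (normal_density 0 (sqrt (t - s)))"
    and W_indep_increments: "\<And>(n :: nat) (t :: nat \<Rightarrow> real). 0 \<le> t 0 \<Longrightarrow> mono_on {..n} t \<Longrightarrow>
          indep_vars (\<lambda>_. borel) (\<lambda>i \<omega>. W (t (Suc i)) \<omega> - W (t i) \<omega>) {..<n}"

text \<open>
  A realisation \<open>(W, Q1, Q2, L)\<close> of the diffusion with parameter \<open>\<beta>\<close>, on some probability space.
  The first equation at \<open>t = 0\<close> forces \<open>L 0 = 0\<close> almost surely; \<open>dL\<close> is the Lebesgue-Stieltjes
  measure of \<open>L\<close>, extended by this value to negative times.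
\<close>

locale reflected_diffusion = brownian_motion M W
  for M :: "'a measure" and W :: "real \<Rightarrow> 'a \<Rightarrow> real" +
  fixes \<beta> :: real and Q1 Q2 L :: "real \<Rightarrow> 'a \<Rightarrow> real"
  assumes Q1_measurable: "\<And>t. 0 \<le> t \<Longrightarrow> Q1 t \<in> borel_measurable M"
    and Q2_measurable: "\<And>t. 0 \<le> t \<Longrightarrow> Q2 t \<in> borel_measurable M"
    and L_measurable: "\<And>t. 0 \<le> t \<Longrightarrow> L t \<in> borel_measurable M"
    and initial_indep: "indep_set
          (sets (vimage_algebra (space M) (\<lambda>\<omega>. (Q1 0 \<omega>, Q2 0 \<omega>)) borel))
          (sets (vimage_algebra (space M) (\<lambda>\<omega>. \<lambda>t\<in>{0..}. W t \<omega>) (PiM {0..} (\<lambda>_. borel))))"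
    and cadlag_paths: "AE \<omega> in M.
          cadlag (\<lambda>t. Q1 t \<omega>) \<and> cadlag (\<lambda>t. Q2 t \<omega>) \<and> cadlag (\<lambda>t. L t \<omega>)"
    and state_space: "AE \<omega> in M. \<forall>t\<ge>0. Q1 t \<omega> \<le> 0 \<and> 0 < Q2 t \<omega>"
    and Q1_eq: "AE \<omega> in M. \<forall>t\<ge>0.
          Q1 t \<omega> = Q1 0 \<omega> + sqrt 2 * W t \<omega> - \<beta> * t
                    + (LINT s:{0..t}|lborel. - Q1 s \<omega> + Q2 s \<omega>) - L t \<omega>"
    and Q2_eq: "AE \<omega> in M. \<forall>t\<ge>0.
          Q2 t \<omega> = Q2 0 \<omega> + L t \<omega> - (LINT s:{0..t}|lborel. Q2 s \<omega>)"
    and L_nondecreasing: "AE \<omega> in M. mono_on {0..} (\<lambda>t. L t \<omega>)"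
    and L_nonneg: "AE \<omega> in M. \<forall>t\<ge>0. 0 \<le> L t \<omega>"
    and L_reflection: "AE \<omega> in M.
          (\<integral>\<^sup>+ t\<in>{0..}. indicator {t. Q1 t \<omega> < 0} t
             \<partial>interval_measure (\<lambda>t. L (max 0 t) \<omega>)) = 0"

text \<open>
  \<open>\<pi>\<close> is stationary if the diffusion, started independently of \<open>W\<close> from \<open>\<pi>\<close>, has law \<open>\<pi>\<close> at
  all times. The type argument only names the sample space carrying the realisation.
\<close>

definition stationary_distribution :: "'a itself \<Rightarrow> real \<Rightarrow> (real \<times> real) measure \<Rightarrow> bool" where
  "stationary_distribution (_ :: 'a itself) \<beta> \<pi> \<longleftrightarrow>
     (\<exists>(M :: 'a measure) W Q1 Q2 L. reflected_diffusion M W \<beta> Q1 Q2 L \<and>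
        (\<forall>t\<ge>0. distr M borel (\<lambda>\<omega>. (Q1 t \<omega>, Q2 t \<omega>)) = \<pi>))"

text \<open>\<^const>\<open>weak_conv_m\<close> for families indexed along an arbitrary filter.\<close>

definition weak_conv_along :: "('i \<Rightarrow> real measure) \<Rightarrow> real measure \<Rightarrow> 'i filter \<Rightarrow> bool" where
  "weak_conv_along N \<mu> F \<longleftrightarrow>
     (\<forall>x. isCont (cdf \<mu>) x \<longrightarrow> ((\<lambda>i. cdf (N i) x) \<longlongrightarrow> cdf \<mu> x) F)"

lemma weak_conv_along_sequentially: "weak_conv_along N \<mu> sequentially \<longleftrightarrow> weak_conv_m N \<mu>"
  by (simp add: weak_conv_along_def weak_conv_m_def weak_conv_def)

end

theory Submission
  imports Defs "HOL-Real_Asymp.Real_Asymp"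
begin

text \<open>
  Write \<open>Y = Q1 + Q2 + \<beta>\<close>. The reflection term \<open>L\<close> cancels in the sum of the two equations, so \<open>Y\<close> is an
  Ornstein--Uhlenbeck process forced by \<open>Q2\<close>:
  $$Y(t) = e^{-t} Y(0) + G_t + \int_0^t e^{-(t-s)} Q_2(s)\,ds,$$
  where $G_t$, the Ornstein--Uhlenbeck process started at 0, has law $N(0, 1 - e^{-2t})$ (lemma
  \<open>ou_law\<close>). The forcing term is nonnegative. As \<open>L\<close> is nondecreasing, $e^{-(t-s)} Q_2(s) \le Q_2(t)$,
  so the forcing term is at most $t\,Q_2(t)$. Together with $Q_1(0) \le 0$ this gives
  $$e^{-t} Y(0) + G_t - Q_2(t) \;\le\; Q_1(t) + \beta \;\le\; e^{-t}\beta + G_t + (t+1)\, Q_2(t)$$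
  (lemmas \<open>q1_lower\<close> and \<open>q1_upper\<close>). In the stationary regime the law of the middle term does not
  depend on \<open>t\<close>. Taking \<open>t = \<beta>\<close> on the right, and \<open>t\<close> to infinity with \<open>\<beta>\<close> fixed on the left, the
  theorem follows as soon as $(\beta + 1)\, Q_2$ tends to 0 in probability under the stationary law.

  This smallness of \<open>Q2\<close> (lemma \<open>Q2_tail\<close>) comes from the Lyapunov function
  $V = Q_2 + \frac15 (\beta/8 + Q_1)^+$. On a time block of length 1/2, with \<open>M\<close> the largest increment of
  $\sqrt 2\,W$ from the beginning of the block, every trajectory satisfies
  $$V_{\mathrm{end}} + \min(V_{\mathrm{start}}/5,\ \beta/160) \;\le\; V_{\mathrm{start}} + C M^4/\beta^3$$
  (lemma \<open>lyapunov_step\<close>). The reason is that \<open>Q2\<close> decays as long as the boundary is not visited, that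
  each visit to the boundary shows that \<open>Q1 + Q2\<close> has decreased at a rate of order \<open>\<beta>\<close>, and that \<open>Q1\<close>
  is driven out of \<open>[-\<beta>/8, 0]\<close> within one block unless \<open>Q2\<close> is of order \<open>\<beta>\<close>. Noise can spoil
  this only when \<open>M\<close> exceeds a multiple of \<open>\<beta>\<close>, which explains the small factor $\beta^{-3}$. Averaging
  over many blocks and using stationarity gives $E \min(V/5, \beta/160) = O(\beta^{-3})$, because
  $E M^4$ is finite by a chaining argument; since $Q_2 \le V$, the required smallness follows.
\<close>

section \<open>Reflected trajectories and their mild form\<close>

text \<open>
  The linear equation $f' = -f + g + K'$ is solved explicitly; since the driving noise $K$ is merely
  continuous, its contribution is written after an integration by parts.
\<close>

lemma variation_of_constants:
  fixes f g K :: "real \<Rightarrow> real"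
  assumes "a \<le> t" and f: "continuous_on {a..t} f" and g: "continuous_on {a..t} g"
    and K: "continuous_on {a..t} K"
    and eq: "\<And>s. s \<in> {a..t} \<Longrightarrow> f s = f a + K s + integral {a..s} (\<lambda>u. g u - f u)"
  shows "f t = exp (a - t) * f a + (K t - integral {a..t} (\<lambda>s. exp (s - t) * K s))
      + integral {a..t} (\<lambda>s. exp (s - t) * g s)"
proof -
  define F where "F s = integral {a..s} (\<lambda>u. g u - f u)" for s
  have F': "(F has_vector_derivative g s - f s) (at s within {a..t})" if "s \<in> {a..t}" for s
    unfolding F_def using that f g
    by (intro integral_has_vector_derivative continuous_intros) auto
  have "((\<lambda>s. exp (s - t) * (F s + f a)) has_real_derivative exp (s - t) * (g s - K s)) (at s within {a..t})"
    if s: "s \<in> {a..t}" for s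
  proof -
    have "(F has_real_derivative g s - f s) (at s within {a..t})"
      using F'[OF s] by (simp add: has_real_derivative_iff_has_vector_derivative)
    then show ?thesis
      using eq[OF s, folded F_def]
      by (auto intro!: derivative_eq_intros simp: algebra_simps)
  qed
  then have "((\<lambda>s. exp (s - t) * (g s - K s)) has_integral
      (exp (t - t) * (F t + f a) - exp (a - t) * (F a + f a))) {a..t}"
    using \<open>a \<le> t\<close> by (intro fundamental_theorem_of_calculus)
       (auto simp: has_real_derivative_iff_has_vector_derivative)
  moreover have "((\<lambda>s. exp (s - t) * (g s - K s)) has_integral
      (integral {a..t} (\<lambda>s. exp (s - t) * g s) - integral {a..t} (\<lambda>s. exp (s - t) * K s))) {a..t}"
    unfolding right_diff_distrib
    by (intro has_integral_diff integrable_integral integrable_continuous_real continuous_intros f g K)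
  ultimately have "F t + f a - exp (a - t) * f a =
     integral {a..t} (\<lambda>s. exp (s - t) * g s) - integral {a..t} (\<lambda>s. exp (s - t) * K s)"
    by (auto dest: has_integral_unique simp: F_def)
  with eq[of t, folded F_def] \<open>a \<le> t\<close> show ?thesis by simp
qed

text \<open>
  For \<open>z = \<surd>2 W\<close> this is the pathwise form of the Ornstein--Uhlenbeck integral
  $\int_0^t e^{-(t-s)}\,dz(s)$, obtained by integration by parts.
\<close>

definition ou :: "(real \<Rightarrow> real) \<Rightarrow> real \<Rightarrow> real" where
  "ou z t = (z t - z 0) - integral {0..t} (\<lambda>s. exp (s - t) * (z s - z 0))"

text \<open>
  The second term measures how far \<open>Q1\<close> intrudes into the zone \<open>[-\<beta>/8, 0]\<close> next to the reflecting
  boundary. Without it, arbitrarily small noise could increase \<open>Q2\<close> whenever \<open>Q1\<close> sits at the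
  boundary, whereas this function decreases as long as the noise is small compared with \<open>\<beta>\<close>.
\<close>

definition lyapunov :: "real \<Rightarrow> real \<times> real \<Rightarrow> real" where
  "lyapunov \<beta> x = snd x + max 0 (\<beta> / 8 + fst x) / 5"

lemma integral_exp_shift:
  fixes a b t :: real
  assumes "a \<le> b"
  shows "integral {a..b} (\<lambda>s. exp (s - t)) = exp (b - t) - exp (a - t)"
proof (rule integral_unique)
  show "((\<lambda>s. exp (s - t)) has_integral (exp (b - t) - exp (a - t))) {a..b}"
    using assms by (intro fundamental_theorem_of_calculus)
      (auto intro!: derivative_eq_intros simp: has_real_derivative_iff_has_vector_derivative[symmetric])
qed

text \<open>
  The deterministic equations satisfied by almost every trajectory, in a form invariant under shifts
  of the time origin. The assumption \<open>l_flat\<close> is the reflection condition stated on intervals.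
\<close>

locale reflected_path =
  fixes \<beta> :: real and z q1 q2 l :: "real \<Rightarrow> real"
  assumes \<beta>_pos: "0 < \<beta>"
    and cont_z: "continuous_on {0..} z" and cont_q1: "continuous_on {0..} q1"
    and cont_q2: "continuous_on {0..} q2" and cont_l: "continuous_on {0..} l"
    and q1_le: "\<And>t. 0 \<le> t \<Longrightarrow> q1 t \<le> 0" and q2_pos: "\<And>t. 0 \<le> t \<Longrightarrow> 0 < q2 t"
    and l_mono: "\<And>s t. 0 \<le> s \<Longrightarrow> s \<le> t \<Longrightarrow> l s \<le> l t"
    and l_flat: "\<And>s t. 0 \<le> s \<Longrightarrow> s \<le> t \<Longrightarrow> (\<And>u. u \<in> {s<..t} \<Longrightarrow> q1 u < 0) \<Longrightarrow> l t = l s"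
    and q1_eq: "\<And>s t. 0 \<le> s \<Longrightarrow> s \<le> t \<Longrightarrow>
      q1 t = q1 s + (z t - z s) - \<beta> * (t - s) + integral {s..t} (\<lambda>u. q2 u - q1 u) - (l t - l s)"
    and q2_eq: "\<And>s t. 0 \<le> s \<Longrightarrow> s \<le> t \<Longrightarrow> q2 t = q2 s + (l t - l s) - integral {s..t} q2"
begin

lemma cont_subset:
  assumes "0 \<le> s"
  shows "continuous_on {s..t} z" "continuous_on {s..t} q1" "continuous_on {s..t} q2"
    "continuous_on {s..t} l"
  using assms by (auto intro: continuous_on_subset[OF cont_z] continuous_on_subset[OF cont_q1]
      continuous_on_subset[OF cont_q2] continuous_on_subset[OF cont_l])

lemma integrable_subset:
  assumes "0 \<le> s"
  shows "q1 integrable_on {s..t}" "q2 integrable_on {s..t}"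
  using cont_subset(2,3)[OF assms] by (auto intro: integrable_continuous_real)

text \<open>
  The pathwise estimates below split at the last visit to the boundary: after it, \<open>l\<close> is
  constant and the two equations decouple from the reflection.
\<close>

lemma last_zero:
  assumes "0 \<le> s" "s \<le> t"
  obtains "\<And>u. u \<in> {s..t} \<Longrightarrow> q1 u < 0"
  | r where "r \<in> {s..t}" "q1 r = 0" "\<And>u. u \<in> {r<..t} \<Longrightarrow> q1 u < 0"
proof (cases "\<exists>u\<in>{s..t}. q1 u = 0")
  case False
  then show ?thesis using q1_le assms by (intro that(1)) (auto simp: less_le)
next
  case True
  define Z where "Z = {u\<in>{s..t}. q1 u = 0}"
  have "closed Z" unfolding Z_def
    using cont_subset(2)[OF assms(1), of t] by (intro continuous_closed_preimage_constant) auto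
  then have "compact Z" unfolding Z_def
    by (metis (no_types, lifting) bounded_closed_interval bounded_subset compact_eq_bounded_closed mem_Collect_eq subsetI)
  then obtain r where r: "r \<in> Z" "\<And>u. u \<in> Z \<Longrightarrow> u \<le> r"
    using True compact_attains_sup[of Z] unfolding Z_def by blast
  have "q1 u < 0" if u: "u \<in> {r<..t}" for u
  proof -
    have "u \<notin> Z" using r(2)[of u] u by auto
    moreover have "q1 u \<le> 0" using q1_le[of u] u r(1) assms unfolding Z_def by auto
    ultimately show ?thesis using u r(1) unfolding Z_def by (auto simp: less_le)
  qed
  with r(1) show ?thesis unfolding Z_def by (intro that(2)) auto
qed

lemma q2_mild:
  assumes "0 \<le> s" "s \<le> t"
  shows "q2 t = exp (s - t) * q2 s + ((l t - l s) - integral {s..t} (\<lambda>u. exp (u - t) * (l u - l s)))"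
proof -
  have "q2 t = exp (s - t) * q2 s + ((l t - l s) - integral {s..t} (\<lambda>u. exp (u - t) * (l u - l s)))
     + integral {s..t} (\<lambda>u. exp (u - t) * 0)"
  proof (rule variation_of_constants)
    show "q2 u = q2 s + (l u - l s) + integral {s..u} (\<lambda>u. 0 - q2 u)" if "u \<in> {s..t}" for u
      using q2_eq[OF assms(1), of u] that by simp
  qed (use assms cont_subset[OF assms(1), of t] in \<open>auto intro!: continuous_intros\<close>)
  then show ?thesis by simp
qed

lemma q2_flat:
  assumes "0 \<le> s" "s \<le> t" "l t = l s"
  shows "q2 t = exp (s - t) * q2 s"
proof -
  have *: "l u - l s = 0" if "u \<in> {s..t}" for u
    using l_mono[of s u] l_mono[of u t] assms that by auto
  have "integral {s..t} (\<lambda>u. exp (u - t) * (l u - l s)) = integral {s..t} (\<lambda>u. 0)"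
    by (rule integral_cong) (simp only: * mult_zero_right)
  then show ?thesis using q2_mild[OF assms(1,2)] assms(3) by simp
qed

text \<open>
  \<open>l\<close> only adds mass to \<open>q2\<close>, so the past of \<open>q2\<close> is controlled by its present. This converts a
  bound on \<open>q2\<close> at one time into a bound on its time integral.
\<close>

lemma q2_decay:
  assumes "0 \<le> s" "s \<le> t"
  shows "exp (s - t) * q2 s \<le> q2 t"
proof -
  have "integral {s..t} (\<lambda>u. exp (u - t) * (l u - l s)) \<le> integral {s..t} (\<lambda>u. exp (u - t) * (l t - l s))"
    using assms cont_subset[OF assms(1), of t] l_mono
    by (intro integral_le integrable_continuous_real continuous_intros) (auto intro!: mult_left_mono)
  also have "\<dots> = (1 - exp (s - t)) * (l t - l s)"
    using integral_exp_shift[OF assms(2), of t] by simp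
  also have "\<dots> \<le> l t - l s"
    using l_mono[OF assms] by (simp add: left_diff_distrib)
  finally show ?thesis using q2_mild[OF assms] by simp
qed

text \<open>
  The reflection term leaves \<open>q1\<close> and enters \<open>q2\<close>, so it cancels in the sum.
\<close>

lemma total_eq:
  assumes "0 \<le> s" "s \<le> t"
  shows "q1 t + q2 t = q1 s + q2 s + (z t - z s) - \<beta> * (t - s) - integral {s..t} q1"
proof -
  have "integral {s..t} (\<lambda>u. q2 u - q1 u) = integral {s..t} q2 - integral {s..t} q1"
    by (rule Henstock_Kurzweil_Integration.integral_diff) (rule integrable_subset[OF assms(1)])+
  then show ?thesis using q1_eq[OF assms] q2_eq[OF assms] by simp
qed

lemma total_mild:
  assumes "0 \<le> t"
  shows "q1 t + q2 t + \<beta> = exp (- t) * (q1 0 + q2 0 + \<beta>) + ou z t + integral {0..t} (\<lambda>s. exp (s - t) * q2 s)"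
proof -
  have "q1 s + q2 s + \<beta> = q1 0 + q2 0 + \<beta> + (z s - z 0)
      + integral {0..s} (\<lambda>u. q2 u - (q1 u + q2 u + \<beta>))" if "s \<in> {0..t}" for s
  proof -
    have "integral {0..s} (\<lambda>u. q2 u - (q1 u + q2 u + \<beta>)) = integral {0..s} (\<lambda>u. - q1 u - \<beta>)"
      by (intro integral_cong) auto
    also have "\<dots> = integral {0..s} (\<lambda>u. - q1 u) - integral {0..s} (\<lambda>u. \<beta>)"
      by (rule Henstock_Kurzweil_Integration.integral_diff)
        (auto intro: integrable_neg integrable_subset)
    also have "\<dots> = - integral {0..s} q1 - \<beta> * s"
      using that by simp
    finally show ?thesis using total_eq[of 0 s] that by simp
  qed
  note eq = this
  have "q1 t + q2 t + \<beta> = exp (0 - t) * (q1 0 + q2 0 + \<beta>)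
     + ((z t - z 0) - integral {0..t} (\<lambda>s. exp (s - t) * (z s - z 0)))
     + integral {0..t} (\<lambda>s. exp (s - t) * q2 s)"
  proof (rule variation_of_constants[where f = "\<lambda>s. q1 s + q2 s + \<beta>"])
    show "q1 s + q2 s + \<beta> = q1 0 + q2 0 + \<beta> + (z s - z 0)
      + integral {0..s} (\<lambda>u. q2 u - (q1 u + q2 u + \<beta>))" if "s \<in> {0..t}" for s
      using that by (rule eq)
  qed (use assms cont_subset[of 0 t] in \<open>auto intro!: continuous_intros\<close>)
  then show ?thesis by (simp add: ou_def)
qed

lemma forcing_bounds:
  assumes "0 \<le> t"
  shows "0 \<le> integral {0..t} (\<lambda>s. exp (s - t) * q2 s)"
    "integral {0..t} (\<lambda>s. exp (s - t) * q2 s) \<le> t * q2 t"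
proof -
  have cont: "continuous_on {0..t} (\<lambda>s. exp (s - t) * q2 s)"
    using cont_subset(3)[of 0 t] by (intro continuous_intros) auto
  show "0 \<le> integral {0..t} (\<lambda>s. exp (s - t) * q2 s)"
  proof (rule integral_nonneg[OF integrable_continuous_real[OF cont]])
    fix s assume "s \<in> {0..t}"
    then show "0 \<le> exp (s - t) * q2 s" using q2_pos[of s] by simp
  qed
  have "integral {0..t} (\<lambda>s. exp (s - t) * q2 s) \<le> integral {0..t} (\<lambda>s. q2 t)"
    by (rule integral_le[OF integrable_continuous_real[OF cont]]) (use q2_decay in auto)
  then show "integral {0..t} (\<lambda>s. exp (s - t) * q2 s) \<le> t * q2 t" using assms by simp
qed

lemma q1_upper:
  assumes "0 \<le> t"
  shows "q1 t + \<beta> \<le> exp (- t) * \<beta> + ou z t + (t + 1) * q2 t"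
proof -
  have "exp (- t) * (q1 0 + q2 0 + \<beta>) \<le> exp (- t) * (q2 0 + \<beta>)"
    using q1_le[of 0] by (intro mult_left_mono) auto
  also have "\<dots> \<le> exp (- t) * \<beta> + q2 t"
    using q2_decay[of 0 t] assms by (simp add: algebra_simps)
  finally show ?thesis
    using total_mild[OF assms] forcing_bounds(2)[OF assms] q2_pos[OF assms] by (simp add: algebra_simps)
qed

lemma q1_lower:
  assumes "0 \<le> t"
  shows "exp (- t) * (q1 0 + q2 0 + \<beta>) + ou z t - q2 t \<le> q1 t + \<beta>"
  using total_mild[OF assms] forcing_bounds(1)[OF assms] by simp

section \<open>A pathwise Lyapunov inequality\<close>

text \<open>
  Since \<open>q2\<close> and \<open>-q1\<close> both push \<open>-q1\<close> downwards, \<open>-q1\<close> grows at rate at most \<open>\<beta>\<close> apart from the noise.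
  The factor 2 comes from comparing the noise at \<open>t\<close> with the noise at the last visit to the boundary.
\<close>

lemma idle_le:
  assumes "0 \<le> a" "a \<le> t" and M: "\<And>s. s \<in> {a..t} \<Longrightarrow> \<bar>z s - z a\<bar> \<le> M"
  shows "- q1 t \<le> - q1 a + 2 * M + \<beta> * (t - a)"
proof -
  have *: "- q1 t \<le> - q1 r - (z t - z r) + \<beta> * (t - r)"
    if "r \<in> {a..t}" "\<And>u. u \<in> {r<..t} \<Longrightarrow> q1 u < 0" for r
  proof -
    have "0 \<le> integral {r..t} (\<lambda>u. q2 u - q1 u)"
    proof (rule integral_nonneg)
      show "(\<lambda>u. q2 u - q1 u) integrable_on {r..t}"
        using that(1) assms(1) by (intro integrable_diff integrable_subset) auto
      fix u assume "u \<in> {r..t}"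
      then have "0 \<le> u" using that(1) assms(1) by auto
      then show "0 \<le> q2 u - q1 u" using q1_le[of u] q2_pos[of u] by linarith
    qed
    moreover have "l t = l r" using that assms by (intro l_flat) auto
    ultimately show ?thesis using q1_eq[of r t] that(1) assms(1) by simp
  qed
  have M0: "0 \<le> M" using M[of a] assms by auto
  from assms(1,2) show ?thesis
  proof (cases rule: last_zero)
    case 1
    have "- q1 t \<le> - q1 a - (z t - z a) + \<beta> * (t - a)" using 1 assms(2) by (intro *) auto
    then show ?thesis using M[of t] assms(2) M0 by (auto simp: abs_le_iff)
  next
    case (2 r)
    have "\<beta> * (t - r) \<le> \<beta> * (t - a)" using 2(1) \<beta>_pos by (intro mult_left_mono) auto
    moreover have "- q1 t \<le> - q1 r - (z t - z r) + \<beta> * (t - r)" using 2 by (intro *) auto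
    moreover have "\<bar>z t - z a\<bar> \<le> M" "\<bar>z r - z a\<bar> \<le> M" using 2 assms(2) by (auto intro: M)
    ultimately show ?thesis using 2(2) q1_le[of a] assms(1) by (simp add: abs_le_iff)
  qed
qed

text \<open>
  Time blocks of length 1/2: long enough for the drift \<open>-\<beta>\<close> to clear the boundary zone, short
  enough that in \<open>q2_at_zero\<close> the feedback of \<open>-q1\<close> makes up for at most half of that drift.
\<close>

context
  fixes a M :: real
  assumes a: "0 \<le> a" and M: "\<And>s. s \<in> {a..a + 1/2} \<Longrightarrow> \<bar>z s - z a\<bar> \<le> M"
begin

lemma M_nonneg: "0 \<le> M" using M[of a] by auto

lemma idle_integral_le:
  assumes "a \<le> t" "t \<le> a + 1/2"
  shows "- integral {a..t} q1 \<le> (t - a) * (- q1 a + 2 * M + \<beta> / 2)"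
proof -
  have "- q1 u \<le> - q1 a + 2 * M + \<beta> / 2" if "u \<in> {a..t}" for u
  proof -
    have "- q1 u \<le> - q1 a + 2 * M + \<beta> * (u - a)"
      using that assms a M by (intro idle_le) auto
    moreover have "\<beta> * (u - a) \<le> \<beta> * (1/2)"
      using that assms \<beta>_pos by (intro mult_left_mono) auto
    ultimately show ?thesis by simp
  qed
  then have "integral {a..t} (\<lambda>u. - q1 u) \<le> integral {a..t} (\<lambda>u. - q1 a + 2 * M + \<beta> / 2)"
    using a by (intro integral_le integrable_neg integrable_subset integrable_const_ivl)
  then show ?thesis using assms by simp
qed

text \<open>
  At the boundary \<open>q2\<close> equals the total \<open>q1 + q2\<close>, whose evolution does not involve the reflection.
  Hence a visit to the boundary at time \<open>t\<close> certifies that the total has lost \<open>\<beta> (t - a)\<close>, up to the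
  feedback \<open>-\<integral>q1\<close> and the noise.
\<close>

lemma q2_at_zero:
  assumes "a \<le> t" "t \<le> a + 1/2" "q1 t = 0"
  shows "q2 t \<le> q2 a + q1 a / 2 + 2 * M - \<beta> * (t - a) / 2"
proof -
  have "q2 t = q1 a + q2 a + (z t - z a) - \<beta> * (t - a) - integral {a..t} q1"
    using total_eq[of a t] a assms by simp
  also have "\<dots> \<le> q1 a + q2 a + M - \<beta> * (t - a) + (t - a) * (- q1 a + 2 * M + \<beta> / 2)"
    using idle_integral_le[OF assms(1,2)] M[of t] assms by auto
  also have "\<dots> = q2 a + (1 - (t - a)) * q1 a + (1 + 2 * (t - a)) * M - \<beta> * (t - a) / 2"
    by (simp add: algebra_simps)
  also have "(1 - (t - a)) * q1 a \<le> (1/2) * q1 a"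
    using assms a q1_le[of a] by (intro mult_right_mono_neg) auto
  also have "(1 + 2 * (t - a)) * M \<le> 2 * M"
    using assms M_nonneg by (intro mult_right_mono) auto
  finally show ?thesis by simp
qed

lemma q2_le:
  assumes "a \<le> t" "t \<le> a + 1/2"
  shows "q2 t \<le> q2 a + 2 * M"
proof -
  have *: "q2 t \<le> q2 r" if "r \<in> {a..t}" "\<And>u. u \<in> {r<..t} \<Longrightarrow> q1 u < 0" for r
  proof -
    have "q2 t = exp (r - t) * q2 r" using that a by (intro q2_flat l_flat) auto
    then show ?thesis using that a q2_pos[of r] by simp
  qed
  from a assms(1) show ?thesis
  proof (cases rule: last_zero)
    case 1
    then show ?thesis using *[of a] assms M_nonneg by force
  next
    case (2 r)
    have "\<beta> * (r - a) \<ge> 0" using 2(1) \<beta>_pos by auto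
    then show ?thesis using *[of r] 2 q2_at_zero[of r] assms q1_le[of a] a by auto
  qed
qed

text \<open>
  The three alternatives: the boundary is not visited, it is last visited in the first half of the
  block (so that \<open>q2\<close> decays freely for a time at least 1/4), or it is last visited in the second half
  (so that the total has lost at least \<open>\<beta>/8\<close> up to noise). The number 4/5 is a convenient bound for $e^{-1/4}$.
\<close>

lemma q2_end:
  "q2 (a + 1/2) \<le> max (4/5 * q2 a) (max (4/5 * (q2 a + q1 a / 2 + 2 * M)) (q2 a + 2 * M - \<beta> / 8))"
proof -
  let ?t = "a + 1/2"
  have e: "exp (- (1/4)) \<le> (4/5 :: real)"
    using exp_ge_add_one_self[of "1/4::real"] by (simp add: exp_minus field_simps)
  have *: "q2 ?t = exp (r - ?t) * q2 r" if "r \<in> {a..?t}" "\<And>u. u \<in> {r<..?t} \<Longrightarrow> q1 u < 0" for r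
    using that a by (intro q2_flat l_flat) auto
  have **: "q2 ?t \<le> 4/5 * q2 r" if "r \<in> {a..a + 1/4}" "\<And>u. u \<in> {r<..?t} \<Longrightarrow> q1 u < 0" for r
  proof -
    have "exp (r - ?t) \<le> exp (- (1/4))" using that by simp
    with e have "exp (r - ?t) \<le> 4/5" by linarith
    then have "exp (r - ?t) * q2 r \<le> 4/5 * q2 r"
      using q2_pos[of r] a that(1) by (intro mult_right_mono) auto
    moreover have "q2 ?t = exp (r - ?t) * q2 r" using that by (intro *) auto
    ultimately show ?thesis by simp
  qed
  have "a \<le> ?t" by simp
  with a show ?thesis
  proof (cases rule: last_zero)
    case 1
    then show ?thesis using **[of a] by auto
  next
    case (2 r)
    show ?thesis
    proof (cases "r \<le> a + 1/4")
      case True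
      have "\<beta> * (r - a) \<ge> 0" using 2(1) \<beta>_pos by auto
      then have "q2 r \<le> q2 a + q1 a / 2 + 2 * M" using 2 q2_at_zero[of r] by auto
      moreover have "q2 ?t \<le> 4/5 * q2 r" using 2 True by (intro **) auto
      ultimately have "q2 ?t \<le> 4/5 * (q2 a + q1 a / 2 + 2 * M)" by argo
      then show ?thesis unfolding le_max_iff_disj by blast
    next
      case False
      have "exp (r - ?t) * q2 r \<le> q2 r"
        using 2(1) q2_pos[of r] a by simp
      moreover have "\<beta> * (1/4) \<le> \<beta> * (r - a)"
        using False \<beta>_pos by (intro mult_left_mono) auto
      ultimately have "q2 ?t \<le> q2 a + 2 * M - \<beta> / 8"
        using *[of r] 2 q2_at_zero[of r] q1_le[of a] a by auto
      then show ?thesis by simp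
    qed
  qed
qed

text \<open>
  The drift carries \<open>q1\<close> away from the boundary, unless \<open>q2\<close> is of order \<open>\<beta>\<close>.
\<close>

lemma idle_end:
  "- q1 (a + 1/2) \<ge> - q1 a / 2 + \<beta> / 4 - q2 a / 2 - 3 * M"
proof -
  let ?t = "a + 1/2"
  have "integral {a..?t} q2 \<le> integral {a..?t} (\<lambda>u. q2 a + 2 * M)"
    using a q2_le by (intro integral_le integrable_subset integrable_const_ivl) auto
  moreover have "integral {a..?t} (\<lambda>u. q2 u - q1 u) = integral {a..?t} q2 - integral {a..?t} q1"
    by (rule Henstock_Kurzweil_Integration.integral_diff) (rule integrable_subset[OF a])+
  ultimately show ?thesis
    using q1_eq[of a ?t] a l_mono[of a ?t] idle_integral_le[of ?t] M[of ?t] by auto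
qed

end

text \<open>
  While the noise stays below \<open>\<beta>/480\<close>, the Lyapunov function contracts by the factor 4/5 or loses
  \<open>\<beta>/160\<close>. If \<open>q2 \<ge> \<beta>/4\<close>, then \<open>q2\<close> loses about \<open>\<beta>/20\<close>, and the boundary term gains at most \<open>\<beta>/40\<close>. If
  \<open>q2 < \<beta>/4\<close> and \<open>-q1 < \<beta>/16\<close>, the boundary term is at least \<open>\<beta>/80\<close> and only noise is left of it, because
  \<open>q1\<close> is driven out of the zone. If \<open>q2 < \<beta>/4\<close> and \<open>-q1 \<ge> \<beta>/16\<close>, then \<open>q1\<close> ends outside the zone, and \<open>q2\<close> decays
  unless it loses \<open>\<beta>/8\<close>. A larger noise costs at most \<open>17 M\<close>, which is absorbed into
  \<open>M\<^sup>4/\<beta>\<^sup>3\<close> because \<open>M > \<beta>/480\<close>.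
\<close>

lemma lyapunov_step:
  assumes a: "0 \<le> a" and M: "\<And>s. s \<in> {a..a + 1/2} \<Longrightarrow> \<bar>z s - z a\<bar> \<le> M"
  shows "lyapunov \<beta> (q1 (a + 1/2), q2 (a + 1/2)) + min (lyapunov \<beta> (q1 a, q2 a) / 5) (\<beta> / 160) \<le> lyapunov \<beta> (q1 a, q2 a) + 17 * 480 ^ 3 * M ^ 4 / \<beta> ^ 3"
proof -
  have M0: "0 \<le> M" by (rule M_nonneg[OF a M])
  define q u q' u' where "q = q2 a" and "u = - q1 a" and "q' = q2 (a + 1/2)" and "u' = - q1 (a + 1/2)"
  have pos: "0 < q" "0 \<le> u" "0 \<le> u'" "0 < q'"
    using a q1_le[of a] q2_pos[of a] q1_le[of "a + 1/2"] q2_pos[of "a + 1/2"] by (auto simp: q_def u_def u'_def q'_def)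
  have q'1: "q' \<le> max (4/5 * q) (max (4/5 * (q - u / 2 + 2 * M)) (q + 2 * M - \<beta> / 8))"
    using q2_end[OF a M] by (simp add: q_def q'_def u_def)
  have q'2: "q' \<le> q + 2 * M" using q2_le[OF a M, of "a + 1/2"] by (simp add: q_def q'_def)
  have u'1: "u' \<ge> u / 2 + \<beta> / 4 - q / 2 - 3 * M"
    using idle_end[OF a M] by (simp add: q_def u_def u'_def)
  obtain p p' g where V: "lyapunov \<beta> (q1 a, q2 a) = q + p / 5" "lyapunov \<beta> (q1 (a + 1/2), q2 (a + 1/2)) = q' + p' / 5"
      "min (lyapunov \<beta> (q1 a, q2 a) / 5) (\<beta> / 160) = g"
    and p: "p = max 0 (\<beta> / 8 - u)" and p': "p' = max 0 (\<beta> / 8 - u')"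
    by (simp add: lyapunov_def q_def u_def q'_def u'_def)
  have "g \<le> lyapunov \<beta> (q1 a, q2 a) / 5" "g \<le> \<beta> / 160" unfolding V(3)[symmetric] by simp_all
  then have g: "g \<le> q / 5 + p / 25" "g \<le> \<beta> / 160" unfolding V(1) by (simp_all add: add_divide_distrib)
  have pp: "0 \<le> p" "\<beta> / 8 - u \<le> p" "0 \<le> p'" "p' \<le> \<beta> / 8"
    unfolding p p' using pos \<beta>_pos by (auto simp: max_def)
  show ?thesis
  proof (cases "M \<le> \<beta> / 480")
    case True
    have "lyapunov \<beta> (q1 (a + 1/2), q2 (a + 1/2)) + min (lyapunov \<beta> (q1 a, q2 a) / 5) (\<beta> / 160) \<le> lyapunov \<beta> (q1 a, q2 a)"
    proof -
      consider "q \<ge> \<beta> / 4" | "q < \<beta> / 4" "u < \<beta> / 16" | "q < \<beta> / 4" "u \<ge> \<beta> / 16" by linarith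
      then show ?thesis
      proof cases
        case 1
        then have "q' \<le> q - \<beta> / 20 + 2 * M"
          using q'1 pos M0 \<beta>_pos by (auto simp: le_max_iff_disj)
        then show ?thesis unfolding V(3) unfolding V using True \<beta>_pos pp g by linarith
      next
        case 2
        then have "p' \<le> 3 * M" unfolding p' using u'1 pos M0 by auto
        then show ?thesis unfolding V(3) unfolding V using True q'2 M0 2 pp g by linarith
      next
        case 3
        then have "\<beta> / 8 - u' \<le> 0" using u'1 True \<beta>_pos by linarith
        then have u': "p' = 0" unfolding p' by simp
        have "q' \<le> 4/5 * q \<or> q' \<le> q + 2 * M - \<beta> / 8"
          using q'1 3 True \<beta>_pos by (auto simp: le_max_iff_disj)
        then show ?thesis
        proof
          assume "q' \<le> 4/5 * q"
          then show ?thesis unfolding V(3) unfolding V u' using g pp by linarith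
        next
          assume "q' \<le> q + 2 * M - \<beta> / 8"
          then show ?thesis unfolding V(3) unfolding V u' using True \<beta>_pos g pp by linarith
        qed
      qed
    qed
    moreover have "0 \<le> 17 * 480 ^ 3 * M ^ 4 / \<beta> ^ 3" using \<beta>_pos M0 by simp
    ultimately show ?thesis by linarith
  next
    case False
    have "lyapunov \<beta> (q1 (a + 1/2), q2 (a + 1/2)) + min (lyapunov \<beta> (q1 a, q2 a) / 5) (\<beta> / 160) \<le> lyapunov \<beta> (q1 a, q2 a) + 17 * M"
      unfolding V(3) unfolding V using False q'2 pp g by linarith
    moreover have "\<beta> ^ 3 \<le> (480 * M) ^ 3" using False \<beta>_pos by (intro power_mono) auto
    then have "M * \<beta> ^ 3 \<le> M * (480 * M) ^ 3" using M0 by (intro mult_left_mono)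
    then have "17 * M \<le> 17 * 480 ^ 3 * M ^ 4 / \<beta> ^ 3"
      using \<beta>_pos by (simp add: field_simps power_mult_distrib eval_nat_numeral)
    ultimately show ?thesis by linarith
  qed
qed

end

section \<open>Regularity of the trajectories\<close>

lemma cadlag_bounded:
  assumes f: "cadlag f" and "0 \<le> T"
  obtains B where "\<And>t. t \<in> {0..T} \<Longrightarrow> \<bar>f t\<bar> \<le> B"
proof -
  \<comment> \<open>The guard \<open>0 \<le> t\<close> is for neighbourhoods of 0, where there is no left limit.\<close>
  have "\<exists>B. \<forall>t\<in>{0..T}. 0 \<le> t \<longrightarrow> \<bar>f t\<bar> \<le> B"
    using \<open>0 \<le> T\<close>
  proof (induction rule: Bolzano[where P = "\<lambda>a b. \<exists>B. \<forall>t\<in>{a..b}. 0 \<le> t \<longrightarrow> \<bar>f t\<bar> \<le> B"])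
    case (trans a b c)
    then obtain B1 B2 where "\<forall>t\<in>{a..b}. 0 \<le> t \<longrightarrow> \<bar>f t\<bar> \<le> B1" "\<forall>t\<in>{b..c}. 0 \<le> t \<longrightarrow> \<bar>f t\<bar> \<le> B2"
      by blast
    then show ?case
      by (intro exI[of _ "max B1 B2"]) (metis atLeastAtMost_iff le_max_iff_disj linorder_le_cases)
  next
    case (local x)
    have "((\<lambda>t. \<bar>f t\<bar>) \<longlongrightarrow> \<bar>f x\<bar>) (at_right x)"
      using f local unfolding cadlag_def by (intro tendsto_intros) auto
    then have "\<forall>\<^sub>F y in at_right x. \<bar>f y\<bar> < \<bar>f x\<bar> + 1"
      by (rule order_tendstoD) simp
    then obtain b where b: "b > x" "\<And>y. x < y \<Longrightarrow> y < b \<Longrightarrow> \<bar>f y\<bar> < \<bar>f x\<bar> + 1"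
      unfolding eventually_at_right_field by blast
    have "\<exists>c<x. \<exists>L. \<forall>y. c < y \<longrightarrow> y < x \<longrightarrow> 0 \<le> y \<longrightarrow> \<bar>f y\<bar> < L"
    proof (cases "x = 0")
      case False
      then obtain l where "(f \<longlongrightarrow> l) (at_left x)" using f local unfolding cadlag_def by force
      then have "((\<lambda>t. \<bar>f t\<bar>) \<longlongrightarrow> \<bar>l\<bar>) (at_left x)" by (intro tendsto_intros)
      then have "\<forall>\<^sub>F y in at_left x. \<bar>f y\<bar> < \<bar>l\<bar> + 1"
        by (rule order_tendstoD) simp
      then show ?thesis unfolding eventually_at_left_field by blast
    qed (auto intro!: exI[of _ "x - 1"])
    then obtain c L where c: "c < x" "\<And>y. c < y \<Longrightarrow> y < x \<Longrightarrow> 0 \<le> y \<Longrightarrow> \<bar>f y\<bar> < L" by blast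
    have "\<bar>f t\<bar> \<le> max L (\<bar>f x\<bar> + 1)" if "p \<le> x" "x \<le> q" "q - p < min (b - x) (x - c)" "t \<in> {p..q}" "0 \<le> t" for p q t
      using b(2)[of t] c(2)[of t] that by (cases t x rule: linorder_cases) auto
    then show ?case
      using b(1) c(1) by (intro exI[of _ "min (b - x) (x - c)"] conjI allI impI exI[of _ "max L (\<bar>f x\<bar> + 1)"] ballI) auto
  qed
  then obtain B where "\<forall>t\<in>{0..T}. \<bar>f t\<bar> \<le> B" by auto
  then show ?thesis by (intro that[of B]) auto
qed

text \<open>
  By right continuity the path is the limit of its values at the next point, strictly to the right,
  of the grid of mesh \<open>1/(n+1)\<close>.
\<close>

lemma cadlag_measurable:
  assumes f: "cadlag f"
  shows "(\<lambda>t. f (max 0 t)) \<in> borel_measurable borel"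
proof (rule borel_measurable_LIMSEQ_real)
  let ?g = "\<lambda>n t. (of_int \<lfloor>max 0 t * (real n + 1)\<rfloor> + 1) / (real n + 1)"
  show "(\<lambda>t. f (?g n t)) \<in> borel_measurable borel" for n
  proof -
    have "(\<lambda>t. \<lfloor>max 0 t * (real n + 1)\<rfloor>) \<in> measurable borel (count_space UNIV)" by measurable
    from measurable_compose[OF this, of "\<lambda>k. f ((of_int k + 1) / (real n + 1))" borel]
    show ?thesis by simp
  qed
  show "(\<lambda>n. f (?g n t)) \<longlonglongrightarrow> f (max 0 t)" for t
  proof (rule filterlim_compose[where g = f])
    show "(f \<longlongrightarrow> f (max 0 t)) (at_right (max 0 t))" using f unfolding cadlag_def by auto
    let ?x = "max 0 t"
    have gt: "?x < ?g n t" and le: "?g n t \<le> ?x + 1 / (real n + 1)" for n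
    proof -
      have "?x * (real n + 1) < of_int \<lfloor>?x * (real n + 1)\<rfloor> + 1"
        by linarith
      then show "?x < ?g n t" by (subst pos_less_divide_eq) auto
      have "of_int \<lfloor>?x * (real n + 1)\<rfloor> + 1 \<le> ?x * (real n + 1) + 1" by linarith
      then have "?g n t \<le> (?x * (real n + 1) + 1) / (real n + 1)" by (intro divide_right_mono) auto
      also have "\<dots> = ?x + 1 / (real n + 1)" by (simp add: field_simps)
      finally show "?g n t \<le> ?x + 1 / (real n + 1)" .
    qed
    have "(\<lambda>n. ?x + 1 / (real n + 1)) \<longlonglongrightarrow> ?x + 0"
      using LIMSEQ_Suc[OF lim_1_over_n] by (intro tendsto_intros) (simp add: add.commute)
    then have "(\<lambda>n. ?g n t) \<longlonglongrightarrow> ?x"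
      using gt le by (intro tendsto_sandwich[of "\<lambda>_. ?x" "\<lambda>n. ?g n t" _ "\<lambda>n. ?x + 1 / (real n + 1)"])
        (auto intro!: always_eventually less_imp_le)
    then show "filterlim (\<lambda>n. ?g n t) (at_right ?x) sequentially"
      unfolding filterlim_at using gt
      by (auto intro!: always_eventually less_imp_neq[THEN not_sym])
  qed
qed

lemma cadlag_set_integrable:
  assumes f: "cadlag f"
  shows "set_integrable lborel {0..T} f"
proof (cases "0 \<le> T")
  case True
  obtain B where B: "\<And>t. t \<in> {0..T} \<Longrightarrow> \<bar>f t\<bar> \<le> B" using cadlag_bounded[OF f True] by blast
  have "integrable lborel (\<lambda>t. indicator {0..T} t *\<^sub>R f (max 0 t))"
    using B cadlag_measurable[OF f] by (intro integrableI_bounded_set_indicator[where B = B]) (auto simp: emeasure_lborel_Icc_eq)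
  then show ?thesis unfolding set_integrable_def
    by (rule Bochner_Integration.integrable_cong[THEN iffD1, rotated 2]) (auto simp: indicator_def)
qed (simp add: set_integrable_def)

lemma continuous_on_Ici_if_compact:
  fixes f :: "real \<Rightarrow> real"
  assumes "\<And>T. continuous_on {0..T} f"
  shows "continuous_on {0..} f"
  unfolding continuous_on_def
proof
  fix x :: real assume "x \<in> {0..}"
  then have "(f \<longlongrightarrow> f x) (at x within {0..x + 1})"
    using assms[of "x + 1"] by (auto simp: continuous_on_def)
  moreover have "at x within {0..x + 1} = at x within {0..}"
    by (rule at_within_nhd[of _ "{..<x + 1}"]) auto
  ultimately show "(f \<longlongrightarrow> f x) (at x within {0..})" by simp
qed

text \<open>
  The point is that \<open>l\<close> has no jumps. The sum \<open>q1 + l\<close> is continuous, so a jump of \<open>l\<close> forces \<open>q1\<close> to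
  jump down by the same amount from a left limit that is at most \<open>0\<close>. Then \<open>q1\<close> is negative at a time
  that carries an atom of \<open>dl\<close>, which the reflection condition excludes. Continuity of \<open>l\<close> passes to
  \<open>q1\<close> and \<open>q2\<close>, and the flatness of \<open>l\<close> off the boundary is the reflection condition on an interval.
\<close>

lemma reflected_path_of_cadlag:
  fixes w q1 q2 l :: "real \<Rightarrow> real"
  assumes \<beta>: "0 < \<beta>" and w: "continuous_on {0..} w"
    and q1: "cadlag q1" and q2: "cadlag q2" and l: "cadlag l"
    and state: "\<And>t. 0 \<le> t \<Longrightarrow> q1 t \<le> 0 \<and> 0 < q2 t"
    and eq1: "\<And>t. 0 \<le> t \<Longrightarrow> q1 t = q1 0 + sqrt 2 * w t - \<beta> * t
        + (LINT s:{0..t}|lborel. - q1 s + q2 s) - l t"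
    and eq2: "\<And>t. 0 \<le> t \<Longrightarrow> q2 t = q2 0 + l t - (LINT s:{0..t}|lborel. q2 s)"
    and mono: "mono_on {0..} l"
    and refl: "(\<integral>\<^sup>+ t\<in>{0..}. indicator {t. q1 t < 0} t \<partial>interval_measure (\<lambda>t. l (max 0 t))) = 0"
  shows "reflected_path \<beta> (\<lambda>t. sqrt 2 * w t) q1 q2 l"
proof -
  define \<mu> where "\<mu> = interval_measure (\<lambda>t. l (max 0 t))"
  have lm: "l s \<le> l t" if "0 \<le> s" "s \<le> t" for s t
    using mono that by (auto simp: mono_on_def)
  have Ioc: "emeasure \<mu> {s<..t} = ennreal (l t - l s)" if "0 \<le> s" "s \<le> t" for s t
  proof -
    have "continuous (at_right a) (\<lambda>t. l (max 0 t))" for a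
    proof (cases "0 \<le> a")
      case True
      have "(l \<longlongrightarrow> l a) (at_right a)" using l True by (simp add: cadlag_def)
      moreover have "\<forall>\<^sub>F t in at_right a. l t = l (max 0 t)"
        using True by (auto simp: eventually_at_right_field intro!: exI[of _ "a + 1"])
      ultimately have "((\<lambda>t. l (max 0 t)) \<longlongrightarrow> l a) (at_right a)"
        by (rule Lim_transform_eventually)
      moreover have "max 0 a = a" using True by simp
      ultimately show ?thesis by (simp only: continuous_within)
    next
      case False
      have "((\<lambda>t. l (max 0 t)) \<longlongrightarrow> l 0) (at_right a)"
        using False by (intro tendsto_eventually) (auto simp: eventually_at_right_field intro!: exI[of _ 0])
      moreover have "max 0 a = 0" using False by simp
      ultimately show ?thesis by (simp only: continuous_within)
    qed
    then have "emeasure \<mu> {s<..t} = l (max 0 t) - l (max 0 s)"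
      unfolding \<mu>_def using that by (intro emeasure_interval_measure_Ioc) (auto intro!: lm)
    then show ?thesis using that by simp
  qed
  have null: "emeasure \<mu> A = 0" if "A \<in> sets borel" "A \<subseteq> {0..}" "\<And>t. t \<in> A \<Longrightarrow> q1 t < 0" for A
  proof -
    have "emeasure \<mu> A = (\<integral>\<^sup>+ t. indicator A t \<partial>\<mu>)"
      using that(1) by (subst nn_integral_indicator) (auto simp: \<mu>_def)
    also have "\<dots> \<le> (\<integral>\<^sup>+ t\<in>{0..}. indicator {t. q1 t < 0} t \<partial>\<mu>)"
      using that by (intro nn_integral_mono) (auto simp: indicator_def)
    finally show ?thesis using refl by (simp add: \<mu>_def)
  qed

  have i1: "q1 integrable_on {0..t}" and i2: "q2 integrable_on {0..t}"
    and L2: "(LINT s:{0..t}|lborel. q2 s) = integral {0..t} q2" for t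
    using set_borel_integral_eq_integral[OF cadlag_set_integrable[OF q1]]
      set_borel_integral_eq_integral[OF cadlag_set_integrable[OF q2]] by auto
  have i12: "(\<lambda>s. q2 s - q1 s) integrable_on {0..t}" for t
    by (intro integrable_diff i1 i2)
  have L1: "(LINT s:{0..t}|lborel. - q1 s + q2 s) = integral {0..t} (\<lambda>s. q2 s - q1 s)" for t
    using set_borel_integral_eq_integral(2)[OF set_integral_diff(1)
      [OF cadlag_set_integrable[OF q2] cadlag_set_integrable[OF q1]]] by simp
  have cI1: "continuous_on {0..} (\<lambda>t. integral {0..t} (\<lambda>s. q2 s - q1 s))"
    and cI2: "continuous_on {0..} (\<lambda>t. integral {0..t} q2)"
    by (intro continuous_on_Ici_if_compact indefinite_integral_continuous_1 i12 i2)+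

  have cq1l: "continuous_on {0..} (\<lambda>t. q1 t + l t)"
  proof -
    have "continuous_on {0..} (\<lambda>t. q1 0 + sqrt 2 * w t - \<beta> * t + integral {0..t} (\<lambda>s. q2 s - q1 s))"
      by (intro continuous_intros w cI1)
    moreover have "q1 0 + sqrt 2 * w t - \<beta> * t + integral {0..t} (\<lambda>s. q2 s - q1 s) = q1 t + l t"
      if "t \<in> {0..}" for t using eq1[of t, unfolded L1] that by auto
    ultimately show ?thesis by (rule continuous_on_eq)
  qed

  have left: "(l \<longlongrightarrow> l t) (at_left t)" if t: "0 < t" for t
  proof -
    obtain x where x: "(l \<longlongrightarrow> x) (at_left t)" using l t by (auto simp: cadlag_def)
    obtain y where y: "(q1 \<longlongrightarrow> y) (at_left t)" using q1 t by (auto simp: cadlag_def)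
    have pos: "\<forall>\<^sub>F s in at_left t. s > 0"
      using t by (auto simp: eventually_at_left_field intro!: exI[of _ 0])
    have y0: "y \<le> 0"
      by (rule tendsto_upperbound[OF y]) (use pos state in \<open>auto elim!: eventually_mono simp: less_imp_le\<close>)
    have x_le: "x \<le> l t"
      by (rule tendsto_upperbound[OF x])
        (use eventually_conj[OF pos eventually_at_left_real[OF t]] lm in \<open>auto elim!: eventually_mono\<close>)
    have lx: "l s \<le> x" if "0 \<le> s" "s < t" for s
      by (rule tendsto_lowerbound[OF x])
        (use eventually_at_left_real[OF that(2)] lm that in \<open>auto elim!: eventually_mono\<close>)
    have "((\<lambda>s. q1 s + l s) \<longlongrightarrow> q1 t + l t) (at t within {0..})"
      using cq1l t by (auto simp: continuous_on_def)
    then have "((\<lambda>s. q1 s + l s) \<longlongrightarrow> q1 t + l t) (at t)"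
      using t by (simp add: at_within_interior[of t "{0..}"])
    then have "((\<lambda>s. q1 s + l s) \<longlongrightarrow> q1 t + l t) (at_left t)"
      by (rule filterlim_mono[OF _ order_refl at_le]) auto
    from tendsto_unique[OF _ this tendsto_add[OF y x]]
    have sum: "q1 t + l t = y + x" by simp
    have "x = l t"
    proof (rule ccontr)
      assume "x \<noteq> l t"
      then have less: "x < l t" using x_le by simp
      then have "q1 t < 0" using sum y0 by linarith
      then have "emeasure \<mu> {t} = 0" using t by (intro null) auto
      \<comment> \<open>The intervals shrink to \<open>{t}\<close>, and each has mass at least the jump \<open>l t - x\<close>.\<close>
      define A where "A n = {t - t / (real n + 1)<..t}" for n
      have A0: "0 \<le> t - t / (real n + 1)" "t - t / (real n + 1) < t" for n
        using t by (auto simp: field_simps)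
      have "(\<lambda>n. emeasure \<mu> (A n)) \<longlonglongrightarrow> emeasure \<mu> (\<Inter>n. A n)"
      proof (rule Lim_emeasure_decseq)
        show "range A \<subseteq> sets \<mu>" by (auto simp: A_def \<mu>_def)
        show "decseq A" unfolding decseq_def A_def using t
          by (auto intro!: divide_left_mono elim!: le_less_trans[rotated])
        show "emeasure \<mu> (A n) \<noteq> \<infinity>" for n
          using A0[of n] unfolding A_def by (subst Ioc) auto
      qed
      moreover have "(\<Inter>n. A n) = {t}"
      proof -
        have "s = t" if s: "s \<in> (\<Inter>n. A n)" for s
        proof (rule ccontr)
          assume "s \<noteq> t"
          then have "s < t" using s by (auto simp: A_def)
          have "(\<lambda>n. t - t / (real n + 1)) \<longlonglongrightarrow> t - 0"
            using tendsto_mult_right[OF LIMSEQ_Suc[OF lim_1_over_n], of t]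
            by (intro tendsto_intros) (simp add: add.commute)
          from order_tendstoD(1)[OF this, of s] \<open>s < t\<close> have "\<forall>\<^sub>F n in sequentially. s < t - t / (real n + 1)" by simp
          then obtain n where "s < t - t / (real n + 1)" by (auto simp: eventually_sequentially)
          moreover have "s \<in> A n" using s by auto
          ultimately show False by (auto simp: A_def)
        qed
        moreover have "t \<in> (\<Inter>n. A n)" using A0 by (auto simp: A_def)
        ultimately show ?thesis by blast
      qed
      moreover have "ennreal (l t - x) \<le> emeasure \<mu> (A n)" for n
        unfolding A_def using A0[of n] lx[of "t - t / (real n + 1)"] by (subst Ioc) (auto intro!: ennreal_leI)
      ultimately have "ennreal (l t - x) \<le> emeasure \<mu> {t}"
        by (intro LIMSEQ_le_const[of "\<lambda>n. emeasure \<mu> (A n)"]) auto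
      then show False using less \<open>emeasure \<mu> {t} = 0\<close> by (simp add: ennreal_eq_0_iff)
    qed
    with x show ?thesis by simp
  qed

  have cl: "continuous_on {0..} l"
    unfolding continuous_on_def
  proof
    fix t :: real assume "t \<in> {0..}"
    then have t: "0 \<le> t" by simp
    have r: "(l \<longlongrightarrow> l t) (at_right t)" using l t by (simp add: cadlag_def)
    show "(l \<longlongrightarrow> l t) (at t within {0..})"
    proof (cases "t = 0")
      case True
      then show ?thesis using r by (simp add: at_within_Ici_at_right)
    next
      case False
      then have "(l \<longlongrightarrow> l t) (at t)" using r left[of t] t by (simp add: filterlim_at_split)
      then show ?thesis by (rule filterlim_mono[OF _ order_refl at_le]) auto
    qed
  qed
  have cq1: "continuous_on {0..} q1"
    using continuous_on_diff[OF cq1l cl] by simp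
  have cq2: "continuous_on {0..} q2"
  proof -
    have "continuous_on {0..} (\<lambda>t. q2 0 + l t - integral {0..t} q2)"
      by (intro continuous_intros cl cI2)
    moreover have "q2 0 + l t - integral {0..t} q2 = q2 t" if "t \<in> {0..}" for t
      using eq2[of t, unfolded L2] that by auto
    ultimately show ?thesis by (rule continuous_on_eq)
  qed
  show ?thesis
  proof
    show "0 < \<beta>" by fact
    show "continuous_on {0..} (\<lambda>t. sqrt 2 * w t)" by (intro continuous_intros w)
    show "l t = l s" if "0 \<le> s" "s \<le> t" "\<And>u. u \<in> {s<..t} \<Longrightarrow> q1 u < 0" for s t
    proof -
      have "emeasure \<mu> {s<..t} = 0" using that by (intro null) auto
      then show ?thesis using Ioc[OF that(1,2)] lm[OF that(1,2)] by (simp add: ennreal_eq_0_iff)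
    qed
    show "q1 t = q1 s + (sqrt 2 * w t - sqrt 2 * w s) - \<beta> * (t - s)
      + integral {s..t} (\<lambda>u. q2 u - q1 u) - (l t - l s)" if "0 \<le> s" "s \<le> t" for s t
    proof -
      have "0 \<le> t" using that by simp
      from eq1[OF that(1), unfolded L1] eq1[OF this, unfolded L1] Henstock_Kurzweil_Integration.integral_combine[OF that i12]
      show ?thesis unfolding right_diff_distrib by linarith
    qed
    show "q2 t = q2 s + (l t - l s) - integral {s..t} q2" if "0 \<le> s" "s \<le> t" for s t
    proof -
      have "0 \<le> t" using that by simp
      from eq2[OF that(1), unfolded L2] eq2[OF this, unfolded L2] Henstock_Kurzweil_Integration.integral_combine[OF that i2]
      show ?thesis by linarith
    qed
  qed (use cq1 cq2 cl state lm in auto)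
qed

section \<open>Suprema of Brownian increments\<close>

text \<open>
  A dyadic point of level \<open>k + 1\<close> is at most one increment of that level away from a dyadic point of
  level \<open>k\<close>, so along a dyadic expansion the increments add up to a geometric series.
\<close>

lemma dyadic_chaining:
  fixes f :: "real \<Rightarrow> real"
  assumes h: "0 < h" and r: "0 < r" "r < 1" and x: "0 \<le> x"
    and cont: "continuous_on {a..a + h} f"
    and inc: "\<And>k j. j < 2 ^ k \<Longrightarrow>
      \<bar>f (a + h * real (Suc j) / 2 ^ k) - f (a + h * real j / 2 ^ k)\<bar> \<le> x * r ^ k"
    and s: "s \<in> {a..a + h}"
  shows "\<bar>f s - f a\<bar> \<le> x / (1 - r)"
proof -
  have dyadic: "\<bar>f (a + h * real j / 2 ^ k) - f a\<bar> \<le> x * (\<Sum>i\<le>k. r ^ i)" if "j \<le> 2 ^ k" for j k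
    using that
  proof (induction k arbitrary: j)
    case 0
    then have "j = 0 \<or> j = 1" by auto
    then show ?case using inc[of 0 0] x by auto
  next
    case (Suc k)
    have sum: "x * (\<Sum>i\<le>Suc k. r ^ i) = x * (\<Sum>i\<le>k. r ^ i) + x * r ^ Suc k"
      by (simp add: algebra_simps)
    have even: "a + h * real (2 * m) / 2 ^ Suc k = a + h * real m / 2 ^ k" for m
      by simp
    show ?case
    proof (cases "even j")
      case True
      then obtain m where m: "j = 2 * m" by blast
      have "0 \<le> x * r ^ Suc k" using x r by simp
      then show ?thesis using Suc.IH[of m] Suc.prems unfolding m even sum by simp
    next
      case False
      then obtain m where m: "j = Suc (2 * m)" by (auto elim!: oddE)
      have "\<bar>f (a + h * real (2 * m) / 2 ^ Suc k) - f a\<bar> \<le> x * (\<Sum>i\<le>k. r ^ i)"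
        unfolding even using Suc.prems m by (intro Suc.IH) auto
      moreover have "\<bar>f (a + h * real j / 2 ^ Suc k) - f (a + h * real (2 * m) / 2 ^ Suc k)\<bar> \<le> x * r ^ Suc k"
        unfolding m using Suc.prems m by (intro inc) auto
      ultimately show ?thesis unfolding sum by linarith
    qed
  qed
  define j where "j k = nat \<lfloor>(s - a) / h * 2 ^ k\<rfloor>" for k
  define p where "p k = a + h * real (j k) / 2 ^ k" for k
  have j: "real (j k) \<le> (s - a) / h * 2 ^ k" "(s - a) / h * 2 ^ k < real (j k) + 1" for k
    using s h unfolding j_def by (auto simp: of_nat_nat)
  have j_le: "j k \<le> 2 ^ k" for k
  proof -
    have "(s - a) / h * 2 ^ k \<le> 1 * 2 ^ k" using s h by (intro mult_right_mono) auto
    from order_trans[OF j(1) this] show ?thesis by simp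
  qed
  have p: "p k \<le> s" "s - h / 2 ^ k \<le> p k" for k
  proof -
    have "h * real (j k) / 2 ^ k \<le> s - a" "s - a \<le> h * (real (j k) + 1) / 2 ^ k"
      using j[of k] h by (simp_all add: field_simps)
    then show "p k \<le> s" "s - h / 2 ^ k \<le> p k"
      by (simp_all add: p_def distrib_left add_divide_distrib)
  qed
  have pa: "p k \<in> {a..a + h}" for k
    using p(1)[of k] s h by (auto simp: p_def)
  have "(\<lambda>k. s - h / 2 ^ k) \<longlonglongrightarrow> s - 0"
    using LIMSEQ_divide_realpow_zero[of 2 h] by (intro tendsto_intros) auto
  then have "p \<longlonglongrightarrow> s"
    using p by (intro tendsto_sandwich[of "\<lambda>k. s - h / 2 ^ k" p _ "\<lambda>_. s"]) auto
  then have "(\<lambda>k. f (p k)) \<longlonglongrightarrow> f s"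
    by (rule continuous_on_tendsto_compose[OF cont _ s]) (use pa in auto)
  then have "(\<lambda>k. \<bar>f (p k) - f a\<bar>) \<longlonglongrightarrow> \<bar>f s - f a\<bar>" by (intro tendsto_intros)
  moreover have "\<bar>f (p k) - f a\<bar> \<le> x / (1 - r)" for k
  proof -
    have "(\<Sum>i\<le>k. r ^ i) \<le> (\<Sum>i. r ^ i)"
      using r by (intro sum_le_suminf) (auto simp: summable_geometric)
    also have "\<dots> = 1 / (1 - r)" using r by (simp add: suminf_geometric)
    finally have "x * (\<Sum>i\<le>k. r ^ i) \<le> x * (1 / (1 - r))" using x by (rule mult_left_mono)
    then show ?thesis using dyadic[OF j_le[of k]] by (simp add: p_def)
  qed
  ultimately show ?thesis by (intro LIMSEQ_le_const2) auto
qed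

text \<open>
  The series \<open>\<Sum>k. A k\<close> itself is the common bound; it is summed in the extended reals, where it is
  measurable and its expectation can be computed before it is known to be finite.
\<close>

lemma (in prob_space) integrable_common_bound:
  fixes A :: "nat \<Rightarrow> 'a \<Rightarrow> real"
  assumes int: "\<And>k. integrable M (A k)" and nonneg: "\<And>k \<omega>. 0 \<le> A k \<omega>"
    and bound: "\<And>k. expectation (A k) \<le> c * \<rho> ^ k" and \<rho>: "0 \<le> \<rho>" "\<rho> < 1"
  obtains X where "integrable M X" "\<And>\<omega>. 0 \<le> X \<omega>" "expectation X \<le> c / (1 - \<rho>)"
    "AE \<omega> in M. \<forall>k. A k \<omega> \<le> X \<omega>"
proof -
  define Y where "Y \<omega> = (\<Sum>k. ennreal (A k \<omega>))" for \<omega>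
  have [measurable]: "A k \<in> borel_measurable M" for k using int by auto
  have c: "0 \<le> c" 
  proof -
    have "0 \<le> expectation (A 0)" by (rule Bochner_Integration.integral_nonneg) (rule nonneg)
    then show ?thesis using bound[of 0] by simp
  qed
  have Y_meas[measurable]: "Y \<in> borel_measurable M" unfolding Y_def by measurable
  have "(\<integral>\<^sup>+ \<omega>. Y \<omega> \<partial>M) = (\<Sum>k. \<integral>\<^sup>+ \<omega>. A k \<omega> \<partial>M)"
    unfolding Y_def by (rule nn_integral_suminf) auto
  also have "\<dots> \<le> (\<Sum>k. ennreal (c * \<rho> ^ k))"
    using bound by (intro suminf_le) (auto simp: nn_integral_eq_integral[OF int] nonneg intro!: ennreal_leI)
  also have "\<dots> = ennreal (c / (1 - \<rho>))"
  proof -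
    have "(\<lambda>k. c * \<rho> ^ k) sums (c * (1 / (1 - \<rho>)))"
      using \<rho> by (intro sums_mult geometric_sums) auto
    then show ?thesis using c \<rho> by (intro suminf_ennreal_eq) auto
  qed
  finally have le: "(\<integral>\<^sup>+ \<omega>. Y \<omega> \<partial>M) \<le> ennreal (c / (1 - \<rho>))" .
  then have "(\<integral>\<^sup>+ \<omega>. Y \<omega> \<partial>M) \<noteq> \<infinity>" by (auto simp: top_unique)
  then have fin: "AE \<omega> in M. Y \<omega> \<noteq> \<infinity>" by (intro nn_integral_PInf_AE) auto
  define X where "X \<omega> = enn2real (Y \<omega>)" for \<omega>
  have eq: "AE \<omega> in M. ennreal (X \<omega>) = Y \<omega>"
    using fin by eventually_elim (auto simp: X_def less_top)
  have X: "(\<integral>\<^sup>+ \<omega>. X \<omega> \<partial>M) \<le> ennreal (c / (1 - \<rho>))"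
    using le nn_integral_cong_AE[OF eq] by simp
  have [measurable]: "X \<in> borel_measurable M" unfolding X_def by measurable
  show ?thesis
  proof
    show "integrable M X"
      using X by (intro integrableI_nonneg) (auto simp: X_def intro: le_less_trans)
    then have "ennreal (expectation X) \<le> ennreal (c / (1 - \<rho>))"
      using X by (subst nn_integral_eq_integral[symmetric]) (auto simp: X_def)
    then show "expectation X \<le> c / (1 - \<rho>)" using c \<rho> by (subst (asm) ennreal_le_iff) auto
    show "0 \<le> X \<omega>" for \<omega> by (simp add: X_def)
    show "AE \<omega> in M. \<forall>k. A k \<omega> \<le> X \<omega>"
      using eq
    proof eventually_elim
      case (elim \<omega>)
      show ?case
      proof
        fix k
        have "ennreal (A k \<omega>) \<le> Y \<omega>"
          unfolding Y_def using sum_le_suminf[of "\<lambda>k. ennreal (A k \<omega>)" "{k}"] by auto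
        then have "ennreal (A k \<omega>) \<le> ennreal (X \<omega>)" using elim by simp
        then show "A k \<omega> \<le> X \<omega>" by (subst (asm) ennreal_le_iff) (auto simp: X_def)
      qed
    qed
  qed
qed

context brownian_motion
begin

lemma increment_fourth_moment:
  assumes "0 \<le> s" "s < t"
  shows "has_bochner_integral M (\<lambda>\<omega>. (W t \<omega> - W s \<omega>) ^ 4) (3 * (t - s)\<^sup>2)"
proof -
  let ?\<sigma> = "sqrt (t - s)"
  note D = W_gaussian_increments[OF assms]
  have "has_bochner_integral lborel (\<lambda>x. normal_density 0 ?\<sigma> x * (x - 0) ^ (2 * 2))
      (fact (2 * 2) / ((2 / ?\<sigma>\<^sup>2) ^ 2 * fact 2))"
    using assms by (intro normal_moment_even) auto
  moreover have "fact (2 * 2) / ((2 / ?\<sigma>\<^sup>2) ^ 2 * fact 2) = 3 * (t - s)\<^sup>2"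
    using assms by (simp add: fact_numeral power_divide)
  ultimately have "has_bochner_integral lborel (\<lambda>x. normal_density 0 ?\<sigma> x * x ^ 4) (3 * (t - s)\<^sup>2)"
    by simp
  then show ?thesis
    using distributed_integrable[OF D, of "\<lambda>x. x ^ 4"] distributed_integral[OF D, of "\<lambda>x. x ^ 4"]
    by (auto simp: has_bochner_integral_iff)
qed

text \<open>
  A Gaussian fourth moment suffices for chaining: at level \<open>k\<close> there are $2^k$ increments with fourth
  moment of order $4^{-k}$, so even after division by $(9/10)^{4k}$ the expected sums decay like
  $(5000/6561)^k$. The factor $10^4 = (1 - 9/10)^{-4}$ is the loss in the geometric series of the chaining.
\<close>

lemma sup_increment_bound:
  assumes a: "0 \<le> a"
  obtains X where "integrable M X" "\<And>\<omega>. 0 \<le> X \<omega>" "expectation X \<le> 4"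
    "AE \<omega> in M. \<forall>s\<in>{a..a + 1/2}. (W s \<omega> - W a \<omega>) ^ 4 \<le> 10 ^ 4 * X \<omega>"
proof -
  \<comment> \<open>Any \<open>r < 1\<close> with \<open>r ^ 4 > 1/2\<close> would do.\<close>
  define r :: real where "r = 9/10"
  define D where "D k j \<omega> = W (a + 1/2 * real (Suc j) / 2 ^ k) \<omega> - W (a + 1/2 * real j / 2 ^ k) \<omega>" for k j :: nat and \<omega>
  define A where "A k \<omega> = (\<Sum>j<2 ^ k. D k j \<omega> ^ 4) / r ^ (4 * k)" for k \<omega>
  have D: "has_bochner_integral M (\<lambda>\<omega>. D k j \<omega> ^ 4) (3 / 4 / 4 ^ k)" for k j
  proof -
    have "3 * ((a + 1/2 * real (Suc j) / 2 ^ k) - (a + 1/2 * real j / 2 ^ k))\<^sup>2 = 3 / 4 / 4 ^ k"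
      by (simp add: field_simps power2_eq_square flip: power_mult_distrib)
    moreover have "has_bochner_integral M (\<lambda>\<omega>. D k j \<omega> ^ 4)
      (3 * ((a + 1/2 * real (Suc j) / 2 ^ k) - (a + 1/2 * real j / 2 ^ k))\<^sup>2)"
      unfolding D_def using a by (intro increment_fourth_moment) (auto simp: divide_strict_right_mono)
    ultimately show ?thesis by simp
  qed
  have A: "has_bochner_integral M (A k) (3/4 * (5000 / 6561) ^ k)" for k
  proof -
    have "has_bochner_integral M (A k) ((\<Sum>j<(2::nat) ^ k. 3 / 4 / 4 ^ k) / r ^ (4 * k))"
      unfolding A_def by (intro has_bochner_integral_divide_zero has_bochner_integral_sum D)
    moreover have "(\<Sum>j<(2::nat) ^ k. 3 / 4 / 4 ^ k) / r ^ (4 * k) = 3/4 * (2 / 4 / r ^ 4) ^ k"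
    proof -
      have "(4::real) ^ k = 2 ^ k * 2 ^ k" by (simp flip: power_mult_distrib)
      then show ?thesis by (simp add: power_divide power_mult)
    qed
    moreover have "2 / 4 / r ^ 4 = 5000 / 6561" by (simp add: r_def eval_nat_numeral)
    ultimately show ?thesis by (simp only:)
  qed
  obtain X where X: "integrable M X" "\<And>\<omega>. 0 \<le> X \<omega>" "expectation X \<le> 3/4 / (1 - 5000 / 6561)"
    "AE \<omega> in M. \<forall>k. A k \<omega> \<le> X \<omega>"
  proof (rule integrable_common_bound[of A])
    show "0 \<le> A k \<omega>" for k \<omega> by (auto simp: A_def r_def intro!: divide_nonneg_nonneg sum_nonneg)
    show "expectation (A k) \<le> 3/4 * (5000 / 6561) ^ k" for k
      using has_bochner_integral_integral_eq[OF A[of k]] by simp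
  qed (use A in \<open>auto simp: has_bochner_integral_iff\<close>)
  have "AE \<omega> in M. \<forall>s\<in>{a..a + 1/2}. (W s \<omega> - W a \<omega>) ^ 4 \<le> 10 ^ 4 * X \<omega>"
    using X(4) W_continuous
  proof eventually_elim
    case (elim \<omega>)
    show ?case
    proof
      fix s assume s: "s \<in> {a..a + 1/2}"
      have "\<bar>W s \<omega> - W a \<omega>\<bar> \<le> root 4 (X \<omega>) / (1 - r)"
      proof (rule dyadic_chaining[where h = "1/2" and a = a])
        show "continuous_on {a..a + 1/2} (\<lambda>t. W t \<omega>)"
          using a by (intro continuous_on_subset[OF elim(2)]) auto
        fix k j :: nat assume "j < 2 ^ k"
        then have "D k j \<omega> ^ 4 \<le> (\<Sum>j<2 ^ k. D k j \<omega> ^ 4)"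
          by (intro member_le_sum) auto
        also have "\<dots> = A k \<omega> * r ^ (4 * k)" by (simp add: A_def r_def)
        also have "\<dots> \<le> X \<omega> * r ^ (4 * k)" using elim by (intro mult_right_mono) (auto simp: r_def)
        also have "\<dots> = (root 4 (X \<omega>) * r ^ k) ^ 4"
          using X(2) by (simp add: power_mult_distrib flip: power_mult) (simp add: mult.commute)
        finally have "\<bar>D k j \<omega>\<bar> ^ 4 \<le> (root 4 (X \<omega>) * r ^ k) ^ 4" by simp
        then have "\<bar>D k j \<omega>\<bar> \<le> root 4 (X \<omega>) * r ^ k"
          using X(2) by (subst (asm) power_mono_iff) (auto simp: r_def)
        then show "\<bar>W (a + 1/2 * real (Suc j) / 2 ^ k) \<omega> - W (a + 1/2 * real j / 2 ^ k) \<omega>\<bar> \<le> root 4 (X \<omega>) * r ^ k"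
          by (simp only: D_def)
      qed (use s X(2) in \<open>auto simp: r_def\<close>)
      then have "\<bar>W s \<omega> - W a \<omega>\<bar> ^ 4 \<le> (root 4 (X \<omega>) / (1 - r)) ^ 4"
        by (intro power_mono) auto
      also have "\<dots> = 10 ^ 4 * X \<omega>"
        using X(2) by (simp add: r_def power_mult_distrib)
      finally show "(W s \<omega> - W a \<omega>) ^ 4 \<le> 10 ^ 4 * X \<omega>" by simp
    qed
  qed
  then show ?thesis using X(1-3) by (intro that[of X]) auto
qed

end

section \<open>Smallness of the second component in the stationary regime\<close>

lemma lyapunov_measurable[measurable]: "lyapunov \<beta> \<in> borel_measurable borel"
  unfolding lyapunov_def by (intro borel_measurable_continuous_onI continuous_intros) simp

lemma lyapunov_ge: "y \<le> lyapunov \<beta> (x, y)"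
  by (simp add: lyapunov_def)

text \<open>
  The factor in front of the fourth-moment bound of \<open>sup_increment_bound\<close> when \<open>lyapunov_step\<close> is
  applied to \<open>z = \<surd>2 W\<close>; the 4 is $(\sqrt 2)^4$.
\<close>

definition noise_cost :: "real \<Rightarrow> real" where
  "noise_cost \<beta> = 17 * 480 ^ 3 * (4 * 10 ^ 4) / \<beta> ^ 3"

definition q2_tail_bound :: "real \<Rightarrow> real \<Rightarrow> real" where
  "q2_tail_bound \<beta> x = 4 * noise_cost \<beta> * (5 / x + 160 / \<beta>)"

lemma (in reflected_diffusion) AE_reflected_path:
  assumes "0 < \<beta>"
  shows "AE \<omega> in M. reflected_path \<beta> (\<lambda>t. sqrt 2 * W t \<omega>) (\<lambda>t. Q1 t \<omega>) (\<lambda>t. Q2 t \<omega>) (\<lambda>t. L t \<omega>)"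
  using W_continuous cadlag_paths state_space Q1_eq Q2_eq L_nondecreasing L_reflection
proof eventually_elim
  case (elim \<omega>)
  then show ?case using assms by (intro reflected_path_of_cadlag) blast+
qed

locale stationary_diffusion = reflected_diffusion +
  fixes \<pi> :: "(real \<times> real) measure"
  assumes \<beta>_pos: "0 < \<beta>"
    and law: "\<And>t. 0 \<le> t \<Longrightarrow> distr M borel (\<lambda>\<omega>. (Q1 t \<omega>, Q2 t \<omega>)) = \<pi>"
begin

lemma Q_measurable[measurable]: "0 \<le> t \<Longrightarrow> (\<lambda>\<omega>. (Q1 t \<omega>, Q2 t \<omega>)) \<in> M \<rightarrow>\<^sub>M borel"
  using Q1_measurable Q2_measurable by (intro borel_measurable_Pair) auto

lemma expectation_stationary:
  fixes f :: "real \<times> real \<Rightarrow> real"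
  assumes "0 \<le> t" and [measurable]: "f \<in> borel_measurable borel"
  shows "expectation (\<lambda>\<omega>. f (Q1 t \<omega>, Q2 t \<omega>)) = integral\<^sup>L \<pi> f"
  unfolding law[OF assms(1), symmetric] using assms by (subst integral_distr) auto

lemma lyapunov_step_AE:
  assumes a: "0 \<le> a"
  obtains X where "integrable M X" "\<And>\<omega>. 0 \<le> X \<omega>" "expectation X \<le> 4"
    "AE \<omega> in M. lyapunov \<beta> (Q1 (a + 1/2) \<omega>, Q2 (a + 1/2) \<omega>)
        + min (lyapunov \<beta> (Q1 a \<omega>, Q2 a \<omega>) / 5) (\<beta> / 160)
      \<le> lyapunov \<beta> (Q1 a \<omega>, Q2 a \<omega>) + noise_cost \<beta> * X \<omega>"
proof -
  obtain X where X: "integrable M X" "\<And>\<omega>. 0 \<le> X \<omega>" "expectation X \<le> 4"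
    "AE \<omega> in M. \<forall>s\<in>{a..a + 1/2}. (W s \<omega> - W a \<omega>) ^ 4 \<le> 10 ^ 4 * X \<omega>"
    using sup_increment_bound[OF a] by blast
  have "AE \<omega> in M. lyapunov \<beta> (Q1 (a + 1/2) \<omega>, Q2 (a + 1/2) \<omega>)
        + min (lyapunov \<beta> (Q1 a \<omega>, Q2 a \<omega>) / 5) (\<beta> / 160)
      \<le> lyapunov \<beta> (Q1 a \<omega>, Q2 a \<omega>) + noise_cost \<beta> * X \<omega>"
    using X(4) AE_reflected_path[OF \<beta>_pos]
  proof eventually_elim
    case (elim \<omega>)
    interpret reflected_path \<beta> "\<lambda>t. sqrt 2 * W t \<omega>" "\<lambda>t. Q1 t \<omega>" "\<lambda>t. Q2 t \<omega>" "\<lambda>t. L t \<omega>"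
      by (rule elim(2))
    define m where "m = root 4 (4 * 10 ^ 4 * X \<omega>)"
    have m: "0 \<le> m" "m ^ 4 = 4 * 10 ^ 4 * X \<omega>" using X(2)[of \<omega>] by (auto simp: m_def)
    have "\<bar>sqrt 2 * W s \<omega> - sqrt 2 * W a \<omega>\<bar> \<le> m" if "s \<in> {a..a + 1/2}" for s
    proof -
      have "sqrt 2 ^ 4 = (4::real)" using real_sqrt_pow2[of 2] by (simp add: power4_eq_xxxx)
      then have "\<bar>sqrt 2 * W s \<omega> - sqrt 2 * W a \<omega>\<bar> ^ 4 = 4 * (W s \<omega> - W a \<omega>) ^ 4"
        by (simp add: power_mult_distrib flip: right_diff_distrib)
      also have "\<dots> \<le> m ^ 4" using elim(1) that unfolding m(2) by auto
      finally show ?thesis using m(1) by (subst (asm) power_mono_iff) auto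
    qed
    from lyapunov_step[OF a this] show ?case by (simp add: m(2) noise_cost_def field_simps)
  qed
  with X show ?thesis by (intro that[of X])
qed

text \<open>
  Summing the Lyapunov inequality over \<open>n\<close> blocks gives
  \<open>\<Sum>k<n. g k \<le> V 0 + \<Sum>k<n. c * X k\<close> for the decrements \<open>g k \<le> b\<close>. By stationarity all \<open>g k\<close> have the
  same expectation, so \<open>E (g 0) \<le> E (min b (V 0 / n)) + 4 c\<close>. The truncation at \<open>b\<close> makes the first
  term vanish as \<open>n\<close> grows even though \<open>V 0\<close> may fail to be integrable.
\<close>

lemma lyapunov_drift_bound:
  "expectation (\<lambda>\<omega>. min (lyapunov \<beta> (Q1 0 \<omega>, Q2 0 \<omega>) / 5) (\<beta> / 160))
    \<le> 4 * noise_cost \<beta>"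
proof -
  define V where "V k \<omega> = lyapunov \<beta> (Q1 (real k / 2) \<omega>, Q2 (real k / 2) \<omega>)" for k :: nat and \<omega>
  define c where "c = noise_cost \<beta>"
  define b where "b = \<beta> / 160"
  define g where "g k \<omega> = min (V k \<omega> / 5) b" for k \<omega>
  have c: "0 \<le> c" and b: "0 < b" using \<beta>_pos by (simp_all add: c_def b_def noise_cost_def)
  have V_meas[measurable]: "V k \<in> borel_measurable M" for k
    unfolding V_def by (rule measurable_compose[OF Q_measurable]) auto
  have g_meas[measurable]: "g k \<in> borel_measurable M" for k
    unfolding g_def by measurable
  have V_nonneg: "AE \<omega> in M. \<forall>k. 0 \<le> V k \<omega>"
    using state_space
  proof eventually_elim
    case (elim \<omega>)
    then have "0 < Q2 (real k / 2) \<omega>" for k by auto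
    then show ?case unfolding V_def by (blast intro: order_trans[OF less_imp_le lyapunov_ge])
  qed
  have "\<exists>X. integrable M X \<and> (\<forall>\<omega>. 0 \<le> X \<omega>) \<and> expectation X \<le> 4 \<and>
      (AE \<omega> in M. V (Suc k) \<omega> + g k \<omega> \<le> V k \<omega> + c * X \<omega>)" for k
  proof -
    have "0 \<le> real k / 2" by simp
    from lyapunov_step_AE[OF this] obtain X where "integrable M X" "\<And>\<omega>. 0 \<le> X \<omega>" "expectation X \<le> 4"
      "AE \<omega> in M. lyapunov \<beta> (Q1 (real k / 2 + 1/2) \<omega>, Q2 (real k / 2 + 1/2) \<omega>)
        + min (lyapunov \<beta> (Q1 (real k / 2) \<omega>, Q2 (real k / 2) \<omega>) / 5) (\<beta> / 160)
      \<le> lyapunov \<beta> (Q1 (real k / 2) \<omega>, Q2 (real k / 2) \<omega>) + noise_cost \<beta> * X \<omega>"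
      by blast
    moreover have "real k / 2 + 1/2 = real (Suc k) / 2" by simp
    ultimately show ?thesis unfolding V_def g_def c_def b_def by (intro exI[of _ X]) auto
  qed
  then obtain X where X: "\<And>k. integrable M (X k)" "\<And>k \<omega>. 0 \<le> X k \<omega>" "\<And>k. expectation (X k) \<le> 4"
    "\<And>k. AE \<omega> in M. V (Suc k) \<omega> + g k \<omega> \<le> V k \<omega> + c * X k \<omega>"
    by metis
  have AE_X: "AE \<omega> in M. \<forall>k. V (Suc k) \<omega> + g k \<omega> \<le> V k \<omega> + c * X k \<omega>"
    using X(4) by (simp add: AE_all_countable)
  have g_bounds: "AE \<omega> in M. \<forall>k. 0 \<le> g k \<omega> \<and> g k \<omega> \<le> b"
    using V_nonneg by eventually_elim (use b in \<open>auto simp: g_def\<close>)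
  have g_int: "integrable M (g k)" for k
    using g_bounds by (intro integrable_const_bound[where B = b]) (auto elim!: eventually_mono)
  have g_eq: "expectation (g k) = expectation (g 0)" for k
    using expectation_stationary[of "real k / 2" "\<lambda>x. min (lyapunov \<beta> x / 5) b"]
      expectation_stationary[of 0 "\<lambda>x. min (lyapunov \<beta> x / 5) b"]
    by (simp add: g_def[abs_def] V_def[abs_def])
  define h where "h n \<omega> = min b (V 0 \<omega> / real (Suc n))" for n \<omega>
  have h_bounds: "AE \<omega> in M. \<forall>n. 0 \<le> h n \<omega> \<and> h n \<omega> \<le> b"
    using V_nonneg by eventually_elim (use b in \<open>auto simp: h_def\<close>)
  have h_meas[measurable]: "h n \<in> borel_measurable M" for n unfolding h_def by measurable
  have h_int: "integrable M (h n)" for n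
    using h_bounds by (intro integrable_const_bound[where B = b]) (auto elim!: eventually_mono)
  have main: "expectation (g 0) \<le> expectation (h n) + c * 4" for n
  proof -
    let ?n = "Suc n"
    have "AE \<omega> in M. (\<Sum>k<?n. g k \<omega>) \<le> real ?n * h n \<omega> + (\<Sum>k<?n. c * X k \<omega>)"
      using AE_X V_nonneg g_bounds
    proof eventually_elim
      case (elim \<omega>)
      have "(\<Sum>k<m. g k \<omega>) + V m \<omega> \<le> V 0 \<omega> + (\<Sum>k<m. c * X k \<omega>)" for m
      proof (induction m)
        case (Suc m)
        have "V (Suc m) \<omega> + g m \<omega> \<le> V m \<omega> + c * X m \<omega>" using elim(1) by blast
        with Suc show ?case by simp
      qed simp
      from this[of ?n] have 1: "(\<Sum>k<?n. g k \<omega>) \<le> V 0 \<omega> + (\<Sum>k<?n. c * X k \<omega>)"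
        using elim(2)[rule_format, of ?n] by linarith
      have "(\<Sum>k<?n. g k \<omega>) \<le> (\<Sum>k<?n. b)" using elim(3) by (intro sum_mono) auto
      moreover have "0 \<le> (\<Sum>k<?n. c * X k \<omega>)" using c X(2) by (intro sum_nonneg mult_nonneg_nonneg)
      ultimately have 2: "(\<Sum>k<?n. g k \<omega>) \<le> real ?n * b + (\<Sum>k<?n. c * X k \<omega>)" by simp
      have "real ?n * h n \<omega> = real ?n * b \<or> real ?n * h n \<omega> = V 0 \<omega>"
        unfolding h_def by (auto simp: min_def)
      then show ?case
        by (rule disjE) (simp_all only: 1 2)
    qed
    then have "expectation (\<lambda>\<omega>. \<Sum>k<?n. g k \<omega>)
        \<le> expectation (\<lambda>\<omega>. real ?n * h n \<omega> + (\<Sum>k<?n. c * X k \<omega>))"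
      using g_int h_int X(1) by (intro integral_mono_AE) auto
    also have "expectation (\<lambda>\<omega>. \<Sum>k<?n. g k \<omega>) = real ?n * expectation (g 0)"
    proof -
      have "expectation (\<lambda>\<omega>. \<Sum>k<?n. g k \<omega>) = (\<Sum>k<?n. expectation (g k))"
        using g_int by (intro Bochner_Integration.integral_sum) auto
      also have "\<dots> = (\<Sum>k<?n. expectation (g 0))" by (intro sum.cong g_eq refl)
      finally show ?thesis by simp
    qed
    also have "expectation (\<lambda>\<omega>. real ?n * h n \<omega> + (\<Sum>k<?n. c * X k \<omega>))
        = real ?n * expectation (h n) + (\<Sum>k<?n. c * expectation (X k))"
    proof -
      have "expectation (\<lambda>\<omega>. real ?n * h n \<omega> + (\<Sum>k<?n. c * X k \<omega>))
        = expectation (\<lambda>\<omega>. real ?n * h n \<omega>) + expectation (\<lambda>\<omega>. \<Sum>k<?n. c * X k \<omega>)"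
        using h_int X(1) by (intro Bochner_Integration.integral_add) auto
      moreover have "expectation (\<lambda>\<omega>. \<Sum>k<?n. c * X k \<omega>) = (\<Sum>k<?n. expectation (\<lambda>\<omega>. c * X k \<omega>))"
        using X(1) by (intro Bochner_Integration.integral_sum) auto
      ultimately show ?thesis by simp
    qed
    also have "\<dots> \<le> real ?n * expectation (h n) + (\<Sum>k<?n. c * 4)"
      using c X(3) by (intro add_left_mono sum_mono mult_left_mono)
    also have "\<dots> = real ?n * (expectation (h n) + c * 4)" by (simp add: algebra_simps)
    finally show ?thesis by (subst (asm) mult_le_cancel_left_pos) auto
  qed
  have "(\<lambda>n. expectation (h n)) \<longlonglongrightarrow> expectation (\<lambda>\<omega>. 0)"
  proof (rule integral_dominated_convergence[where w = "\<lambda>_. b"])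
    show "AE \<omega> in M. (\<lambda>n. h n \<omega>) \<longlonglongrightarrow> 0"
    proof (rule AE_I2)
      fix \<omega>
      have "(\<lambda>n. V 0 \<omega> * (1 / real (Suc n))) \<longlonglongrightarrow> V 0 \<omega> * 0"
        by (intro tendsto_intros LIMSEQ_Suc[OF lim_1_over_n])
      then have "(\<lambda>n. h n \<omega>) \<longlonglongrightarrow> min b 0"
        unfolding h_def by (intro tendsto_intros) simp
      then show "(\<lambda>n. h n \<omega>) \<longlonglongrightarrow> 0" using b by simp
    qed
    show "AE \<omega> in M. norm (h n \<omega>) \<le> b" for n
      using h_bounds by (auto elim!: eventually_mono)
  qed auto
  then have "(\<lambda>n. expectation (h n) + c * 4) \<longlonglongrightarrow> 0 + c * 4" by (intro tendsto_intros) simp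
  from LIMSEQ_le_const[OF this] main have "expectation (g 0) \<le> c * 4" by auto
  then show ?thesis by (simp add: g_def[abs_def] V_def[abs_def] b_def c_def)
qed

lemma Q2_tail:
  assumes t: "0 \<le> t" and x: "0 < x"
  shows "prob {\<omega>\<in>space M. x < Q2 t \<omega>} \<le> q2_tail_bound \<beta> x"
proof -
  define c where "c = 4 * noise_cost \<beta>"
  define g where "g y = min (lyapunov \<beta> y / 5) (\<beta> / 160)" for y
  define m where "m = min (x / 5) (\<beta> / 160)"
  have m: "0 < m" using x \<beta>_pos by (simp add: m_def)
  have c: "0 \<le> c" using \<beta>_pos by (simp add: c_def noise_cost_def)
  have [measurable]: "g \<in> borel_measurable borel" unfolding g_def by measurable
  have gQ[measurable]: "(\<lambda>\<omega>. g (Q1 t \<omega>, Q2 t \<omega>)) \<in> borel_measurable M"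
    by (rule measurable_compose[OF Q_measurable[OF t]]) measurable
  have bounds: "AE \<omega> in M. 0 \<le> g (Q1 t \<omega>, Q2 t \<omega>) \<and> g (Q1 t \<omega>, Q2 t \<omega>) \<le> \<beta> / 160"
    using state_space
  proof eventually_elim
    case (elim \<omega>)
    then have "0 < Q2 t \<omega>" using t by auto
    then have "0 \<le> lyapunov \<beta> (Q1 t \<omega>, Q2 t \<omega>)"
      by (blast intro: order_trans[OF less_imp_le lyapunov_ge])
    then show ?case using \<beta>_pos by (auto simp: g_def)
  qed
  have "prob {\<omega>\<in>space M. x < Q2 t \<omega>} \<le> prob {\<omega>\<in>space M. m \<le> g (Q1 t \<omega>, Q2 t \<omega>)}"
  proof (rule finite_measure_mono)
    show "{\<omega>\<in>space M. x < Q2 t \<omega>} \<subseteq> {\<omega>\<in>space M. m \<le> g (Q1 t \<omega>, Q2 t \<omega>)}"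
    proof safe
      fix \<omega> assume "x < Q2 t \<omega>"
      then have "x \<le> lyapunov \<beta> (Q1 t \<omega>, Q2 t \<omega>)" by (rule order_trans[OF less_imp_le lyapunov_ge])
      then show "m \<le> g (Q1 t \<omega>, Q2 t \<omega>)" unfolding m_def g_def by (intro min.mono) auto
    qed
  qed measurable
  also have "\<dots> \<le> expectation (\<lambda>\<omega>. g (Q1 t \<omega>, Q2 t \<omega>)) / m"
  proof (rule integral_Markov_inequality_measure[where A = "{}"])
    show "integrable M (\<lambda>\<omega>. g (Q1 t \<omega>, Q2 t \<omega>))"
    proof (rule integrable_const_bound)
      show "AE \<omega> in M. norm (g (Q1 t \<omega>, Q2 t \<omega>)) \<le> \<beta> / 160" using bounds by eventually_elim auto
    qed simp
    show "AE \<omega> in M. 0 \<le> g (Q1 t \<omega>, Q2 t \<omega>)" using bounds by eventually_elim auto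
  qed (use m in auto)
  also have "\<dots> \<le> c / m"
  proof (rule divide_right_mono)
    have "expectation (\<lambda>\<omega>. g (Q1 t \<omega>, Q2 t \<omega>)) = expectation (\<lambda>\<omega>. g (Q1 0 \<omega>, Q2 0 \<omega>))"
      using t by (simp add: expectation_stationary)
    then show "expectation (\<lambda>\<omega>. g (Q1 t \<omega>, Q2 t \<omega>)) \<le> c"
      using lyapunov_drift_bound by (simp add: g_def c_def)
  qed (use m in simp)
  also have "c / m = c * (1 / m)" by simp
  also have "\<dots> \<le> c * (5 / x + 160 / \<beta>)"
    using x \<beta>_pos by (intro mult_left_mono c) (auto simp: m_def min_def)
  finally show ?thesis by (simp only: c_def q2_tail_bound_def)
qed

end

section \<open>The law of the Ornstein--Uhlenbeck integral\<close>

text \<open>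
  Summation by parts turns the sum into a Riemann sum for \<open>\<integral>e\<^sup>s z s\<close>, in which \<open>z\<close> is replaced on each
  interval by its right endpoint value; the weights \<open>exp (p (i+1) - t) - exp (p i - t)\<close> telescope.
\<close>

lemma riemann_stieltjes_error:
  fixes p :: "nat \<Rightarrow> real" and z :: "real \<Rightarrow> real"
  assumes p: "\<And>i. i < m \<Longrightarrow> p i \<le> p (Suc i)"
    and z: "continuous_on {p 0..p m} z" "z (p 0) = 0"
    and \<epsilon>: "\<And>i s. i < m \<Longrightarrow> s \<in> {p i..p (Suc i)} \<Longrightarrow> \<bar>z s - z (p (Suc i))\<bar> \<le> \<epsilon>"
  shows "\<bar>(\<Sum>i<m. exp (p i - t) * (z (p (Suc i)) - z (p i)))
      - (exp (p m - t) * z (p m) - integral {p 0..p m} (\<lambda>s. exp (s - t) * z s))\<bar>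
    \<le> \<epsilon> * (exp (p m - t) - exp (p 0 - t))"
  using p z(1) \<epsilon>
proof (induction m)
  case 0
  then show ?case using z(2) by simp
next
  case (Suc m)
  let ?a = "p m" and ?b = "p (Suc m)"
  have ab: "?a \<le> ?b" using Suc.prems(1)[of m] by simp
  have 0: "p 0 \<le> p j" if "j \<le> m" for j
    using that by (induction j) (auto intro: order_trans[OF _ Suc.prems(1)])
  have c1: "continuous_on {p 0..?a} z" using ab by (intro continuous_on_subset[OF Suc.prems(2)]) auto
  have c2: "continuous_on {?a..?b} z" using 0[of m] by (intro continuous_on_subset[OF Suc.prems(2)]) auto
  have "integral {p 0..?a} (\<lambda>s. exp (s - t) * z s) + integral {?a..?b} (\<lambda>s. exp (s - t) * z s)
      = integral {p 0..?b} (\<lambda>s. exp (s - t) * z s)"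
    using 0[of m] ab
    by (intro Henstock_Kurzweil_Integration.integral_combine integrable_continuous_real continuous_intros Suc.prems(2)) auto
  moreover have "\<bar>integral {?a..?b} (\<lambda>s. exp (s - t) * z s) - (exp (?b - t) - exp (?a - t)) * z ?b\<bar>
      \<le> \<epsilon> * (exp (?b - t) - exp (?a - t))"
  proof -
    have "norm (integral {?a..?b} (\<lambda>s. exp (s - t) * z s - exp (s - t) * z ?b))
        \<le> integral {?a..?b} (\<lambda>s. exp (s - t) * \<epsilon>)"
    proof (rule Henstock_Kurzweil_Integration.integral_norm_bound_integral)
      fix s assume "s \<in> {?a..?b}"
      then have "\<bar>z s - z ?b\<bar> \<le> \<epsilon>" using Suc.prems(3)[of m s] by simp
      then show "norm (exp (s - t) * z s - exp (s - t) * z ?b) \<le> exp (s - t) * \<epsilon>"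
        by (simp add: abs_mult flip: right_diff_distrib)
    qed (intro integrable_continuous_real continuous_intros c2)+
    also have "integral {?a..?b} (\<lambda>s. exp (s - t) * \<epsilon>) = \<epsilon> * (exp (?b - t) - exp (?a - t))"
      using integral_exp_shift[OF ab, of t] by simp
    also have "integral {?a..?b} (\<lambda>s. exp (s - t) * z s - exp (s - t) * z ?b)
        = integral {?a..?b} (\<lambda>s. exp (s - t) * z s) - integral {?a..?b} (\<lambda>s. exp (s - t) * z ?b)"
      by (intro Henstock_Kurzweil_Integration.integral_diff integrable_continuous_real continuous_intros c2)
    also have "integral {?a..?b} (\<lambda>s. exp (s - t) * z ?b) = (exp (?b - t) - exp (?a - t)) * z ?b"
      using integral_exp_shift[OF ab, of t] by simp
    finally show ?thesis by simp
  qed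
  moreover have "\<bar>(\<Sum>i<m. exp (p i - t) * (z (p (Suc i)) - z (p i)))
      - (exp (?a - t) * z ?a - integral {p 0..?a} (\<lambda>s. exp (s - t) * z s))\<bar>
    \<le> \<epsilon> * (exp (?a - t) - exp (p 0 - t))"
    using Suc.prems(1,3) c1 by (intro Suc.IH) auto
  moreover have "(\<Sum>i<Suc m. exp (p i - t) * (z (p (Suc i)) - z (p i)))
    = (\<Sum>i<m. exp (p i - t) * (z (p (Suc i)) - z (p i))) + (exp (?a - t) * z ?b - exp (?a - t) * z ?a)"
    by (simp add: right_diff_distrib)
  ultimately show ?case
    unfolding left_diff_distrib right_diff_distrib by (simp only: abs_le_iff) linarith
qed

text \<open>
  The left-endpoint sums are used because, for Brownian \<open>z\<close>, they are sums of independent Gaussians.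
\<close>

definition ou_sum :: "(real \<Rightarrow> real) \<Rightarrow> real \<Rightarrow> nat \<Rightarrow> real" where
  "ou_sum z t n = (\<Sum>i<n. exp (t * real i / real n - t) * (z (t * real (Suc i) / real n) - z (t * real i / real n)))"

lemma ou_sum_tendsto:
  assumes t: "0 \<le> t" and z: "continuous_on {0..t} z"
  shows "(\<lambda>n. ou_sum z t (Suc n)) \<longlonglongrightarrow> ou z t"
proof (rule LIMSEQ_I)
  fix e :: real assume e: "0 < e"
  define \<zeta> where "\<zeta> s = z s - z 0" for s
  have \<zeta>: "continuous_on {0..t} \<zeta>" unfolding \<zeta>_def by (intro continuous_intros z)
  then have "uniformly_continuous_on {0..t} \<zeta>" by (intro compact_uniformly_continuous) auto
  then obtain d where d: "d > 0" "\<And>x y. x \<in> {0..t} \<Longrightarrow> y \<in> {0..t} \<Longrightarrow> \<bar>y - x\<bar> < d \<Longrightarrow> \<bar>\<zeta> y - \<zeta> x\<bar> < e / 2"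
    using e unfolding uniformly_continuous_on_def dist_real_def by (meson half_gt_zero)
  obtain N :: nat where N: "t / d < real N" using reals_Archimedean2 by blast
  have "norm (ou_sum z t (Suc n) - ou z t) < e" if n: "n \<ge> N" for n
  proof -
    define p where "p i = t * real i / real (Suc n)" for i
    have mesh: "p (Suc i) - p i = t / real (Suc n)" for i
      unfolding p_def diff_divide_distrib[symmetric] right_diff_distrib[symmetric] by simp
    have small: "t / real (Suc n) < d"
    proof -
      have "t / d < real (Suc n)" using N n by linarith
      then show ?thesis using d(1) by (simp add: field_simps)
    qed
    have mono: "p i \<le> p (Suc i)" for i
      using mesh[of i] divide_nonneg_nonneg[OF t, of "real (Suc n)"] by linarith
    have range: "p i \<in> {0..t}" if "i \<le> Suc n" for i
    proof -
      have "t * real i \<le> t * real (Suc n)" using t that by (intro mult_left_mono) auto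
      then show ?thesis using t by (simp add: p_def pos_divide_le_eq)
    qed
    have p0: "p 0 = 0" and pn: "p (Suc n) = t" by (simp_all add: p_def)
    have "\<bar>(\<Sum>i<Suc n. exp (p i - t) * (\<zeta> (p (Suc i)) - \<zeta> (p i)))
      - (exp (p (Suc n) - t) * \<zeta> (p (Suc n)) - integral {p 0..p (Suc n)} (\<lambda>s. exp (s - t) * \<zeta> s))\<bar>
      \<le> (e / 2) * (exp (p (Suc n) - t) - exp (p 0 - t))"
    proof (rule riemann_stieltjes_error)
      show "continuous_on {p 0..p (Suc n)} \<zeta>" unfolding p0 pn by (rule \<zeta>)
      show "\<zeta> (p 0) = 0" by (simp add: p0 \<zeta>_def)
      fix i s assume i: "i < Suc n" and s: "s \<in> {p i..p (Suc i)}"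
      have "s \<in> {0..t}" "p (Suc i) \<in> {0..t}" using range[of i] range[of "Suc i"] i s by auto
      moreover have "\<bar>s - p (Suc i)\<bar> < d" using s mesh[of i] small by auto
      ultimately show "\<bar>\<zeta> s - \<zeta> (p (Suc i))\<bar> \<le> e / 2" using d(2)[of "p (Suc i)" s] by auto
    qed (rule mono)
    note error = this
    have sum: "(\<Sum>i<Suc n. exp (p i - t) * (\<zeta> (p (Suc i)) - \<zeta> (p i))) = ou_sum z t (Suc n)"
      unfolding ou_sum_def p_def \<zeta>_def by simp
    have lim: "exp (p (Suc n) - t) * \<zeta> (p (Suc n)) - integral {p 0..p (Suc n)} (\<lambda>s. exp (s - t) * \<zeta> s) = ou z t"
      unfolding p0 pn ou_def \<zeta>_def by simp
    have "(e / 2) * (exp (p (Suc n) - t) - exp (p 0 - t)) \<le> (e / 2) * 1"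
      unfolding p0 pn using e by (intro mult_left_mono) auto
    from order_trans[OF error[unfolded sum lim] this] show ?thesis using e by simp
  qed
  then show "\<exists>N. \<forall>n\<ge>N. norm (ou_sum z t (Suc n) - ou z t) < e" by blast
qed

text \<open>
  With \<open>h = 2t/(n+1)\<close> the variance is a geometric sum and equals $h (1 - e^{-2t}) / (e^h - 1)$.
\<close>

lemma ou_sum_variance_tendsto:
  assumes t: "0 < t"
  shows "(\<lambda>n. \<Sum>i<Suc n. (exp (t * real i / real (Suc n) - t) * sqrt (2 * (t / real (Suc n))))\<^sup>2)
    \<longlonglongrightarrow> 1 - exp (- 2 * t)"
proof -
  define h where "h n = 2 * t / real (Suc n)" for n
  have h: "h n > 0" for n using t by (simp add: h_def)
  have h0: "h \<longlonglongrightarrow> 0"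
    using tendsto_mult_right[OF LIMSEQ_Suc[OF lim_1_over_n], of "2 * t"] by (simp add: h_def[abs_def])
  have "((\<lambda>x::real. (exp x - 1) / x) \<longlongrightarrow> 1) (at 0)"
    using DERIV_exp[of "0::real"] by (simp add: has_field_derivative_iff)
  moreover have "filterlim h (at 0) sequentially"
    unfolding filterlim_at using h0 h by (auto intro!: always_eventually less_imp_neq[THEN not_sym])
  ultimately have "(\<lambda>n. (exp (h n) - 1) / h n) \<longlonglongrightarrow> 1" by (rule filterlim_compose)
  then have "(\<lambda>n. (1 - exp (- 2 * t)) / ((exp (h n) - 1) / h n)) \<longlonglongrightarrow> (1 - exp (- 2 * t)) / 1"
    by (intro tendsto_intros) auto
  moreover have "(1 - exp (- 2 * t)) / ((exp (h n) - 1) / h n)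
      = (\<Sum>i<Suc n. (exp (t * real i / real (Suc n) - t) * sqrt (2 * (t / real (Suc n))))\<^sup>2)" for n
  proof -
    have "(exp (t * real i / real (Suc n) - t) * sqrt (2 * (t / real (Suc n))))\<^sup>2
        = h n * exp (- 2 * t) * exp (h n) ^ i" for i
    proof -
      have "(sqrt (2 * (t / real (Suc n))))\<^sup>2 = h n" using t by (simp add: h_def)
      moreover have "(exp (t * real i / real (Suc n) - t))\<^sup>2 = exp (- 2 * t) * exp (h n) ^ i"
      proof -
        have "2 * (t * x / N - t) = - 2 * t + x * (2 * t / N)" for x N :: real
          by (simp add: right_diff_distrib)
        then have "2 * (t * real i / real (Suc n) - t) = - 2 * t + real i * h n"
          by (simp only: h_def)
        then show ?thesis by (simp only: exp_double[symmetric] exp_add exp_of_nat_mult)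
      qed
      ultimately show ?thesis by (simp add: power_mult_distrib)
    qed
    then have "(\<Sum>i<Suc n. (exp (t * real i / real (Suc n) - t) * sqrt (2 * (t / real (Suc n))))\<^sup>2)
        = h n * exp (- 2 * t) * (\<Sum>i<Suc n. exp (h n) ^ i)" by (simp only: sum_distrib_left)
    also have "(\<Sum>i<Suc n. exp (h n) ^ i) = (exp (h n) ^ Suc n - 1) / (exp (h n) - 1)"
      using h[of n] by (intro geometric_sum) auto
    also have "exp (h n) ^ Suc n = exp (2 * t)"
      by (simp add: h_def exp_of_nat_mult[symmetric] del: power_Suc of_nat_Suc)
    also have "h n * exp (- 2 * t) * ((exp (2 * t) - 1) / (exp (h n) - 1)) = (1 - exp (- 2 * t)) / ((exp (h n) - 1) / h n)"
      by (simp add: right_diff_distrib exp_minus_inverse algebra_simps flip: exp_add)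
    finally show ?thesis by simp
  qed
  ultimately show ?thesis by simp
qed

context brownian_motion
begin

lemma ou_sum_normal:
  assumes t: "0 < t"
  shows "distributed M lborel (\<lambda>\<omega>. ou_sum (\<lambda>s. sqrt 2 * W s \<omega>) t (Suc n))
    (normal_density 0 (sqrt (\<Sum>i<Suc n. (exp (t * real i / real (Suc n) - t) * sqrt (2 * (t / real (Suc n))))\<^sup>2)))"
proof -
  define p where "p i = t * real i / real (Suc n)" for i
  have p0: "0 \<le> p i" for i using t by (simp add: p_def)
  have mesh: "p (Suc i) - p i = t / real (Suc n)" for i
    unfolding p_def diff_divide_distrib[symmetric] right_diff_distrib[symmetric] by simp
  have mono: "p i \<le> p j" if "i \<le> j" for i j
    unfolding p_def using that t by (intro divide_right_mono mult_left_mono) auto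
  have "indep_vars (\<lambda>_. borel) (\<lambda>i \<omega>. W (p (Suc i)) \<omega> - W (p i) \<omega>) {..<Suc n}"
    using p0 mono by (intro W_indep_increments) (auto simp: mono_on_def)
  from indep_vars_compose2[OF this, of "\<lambda>i x. 0 + (exp (p i - t) * sqrt 2) * x" "\<lambda>_. borel"]
  have "indep_vars (\<lambda>_. borel) (\<lambda>i \<omega>. 0 + (exp (p i - t) * sqrt 2) * (W (p (Suc i)) \<omega> - W (p i) \<omega>)) {..<Suc n}"
    by simp
  then have "distributed M lborel (\<lambda>\<omega>. \<Sum>i<Suc n. 0 + (exp (p i - t) * sqrt 2) * (W (p (Suc i)) \<omega> - W (p i) \<omega>))
    (normal_density (\<Sum>i<Suc n. 0 + (exp (p i - t) * sqrt 2) * 0)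
      (sqrt (\<Sum>i<Suc n. (\<bar>exp (p i - t) * sqrt 2\<bar> * sqrt (t / real (Suc n)))\<^sup>2)))"
  proof (intro sum_indep_normal)
    fix i
    have "p i < p (Suc i)"
      using mesh[of i] divide_pos_pos[OF t, of "real (Suc n)"] by linarith
    from W_gaussian_increments[OF p0 this]
    have "distributed M lborel (\<lambda>\<omega>. W (p (Suc i)) \<omega> - W (p i) \<omega>) (normal_density 0 (sqrt (t / real (Suc n))))"
      unfolding mesh .
    from normal_density_affine[OF this, of "exp (p i - t) * sqrt 2" 0] t
    show "distributed M lborel (\<lambda>\<omega>. 0 + (exp (p i - t) * sqrt 2) * (W (p (Suc i)) \<omega> - W (p i) \<omega>))
      (normal_density (0 + (exp (p i - t) * sqrt 2) * 0) (\<bar>exp (p i - t) * sqrt 2\<bar> * sqrt (t / real (Suc n))))"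
      by simp
  qed (use t in auto)
  moreover have "(\<Sum>i<Suc n. 0 + (exp (p i - t) * sqrt 2) * (W (p (Suc i)) \<omega> - W (p i) \<omega>))
      = ou_sum (\<lambda>s. sqrt 2 * W s \<omega>) t (Suc n)" for \<omega>
    unfolding ou_sum_def p_def by (intro sum.cong refl) (simp add: algebra_simps)
  moreover have "\<bar>exp (p i - t) * sqrt 2\<bar> * sqrt (t / real (Suc n)) = exp (p i - t) * sqrt (2 * (t / real (Suc n)))" for i
    by (simp add: abs_mult real_sqrt_mult real_sqrt_divide)
  ultimately show ?thesis by (simp only: p_def) simp
qed

text \<open>
  The sums converge almost surely and their laws are centred Gaussian with converging variance, so
  characteristic functions identify the law of the limit. The variable \<open>N\<close> is a measurable version
  of the integral, whose pathwise definition makes sense only for continuous trajectories.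
\<close>

lemma ou_law:
  assumes t: "0 < t"
  obtains N where "N \<in> borel_measurable M" "AE \<omega> in M. N \<omega> = ou (\<lambda>s. sqrt 2 * W s \<omega>) t"
    "\<And>y. prob {\<omega>\<in>space M. N \<omega> \<le> y} = cdf std_normal_distribution (y / sqrt (1 - exp (- 2 * t)))"
proof -
  define G where "G n \<omega> = ou_sum (\<lambda>s. sqrt 2 * W s \<omega>) t (Suc n)" for n \<omega>
  define v where "v n = (\<Sum>i<Suc n. (exp (t * real i / real (Suc n) - t) * sqrt (2 * (t / real (Suc n))))\<^sup>2)" for n
  define \<sigma> where "\<sigma> = sqrt (1 - exp (- 2 * t))"
  have \<sigma>: "0 < \<sigma>" using t by (simp add: \<sigma>_def)
  have v_pos: "0 < v n" for n unfolding v_def using t by (intro sum_pos) auto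
  have v_lim: "(\<lambda>n. sqrt (v n)) \<longlonglongrightarrow> \<sigma>"
    unfolding v_def \<sigma>_def by (intro tendsto_intros ou_sum_variance_tendsto t)
  have G_normal: "distributed M lborel (G n) (normal_density 0 (sqrt (v n)))" for n
    using ou_sum_normal[OF t, of n] by (simp only: G_def[abs_def] v_def)
  have G_meas[measurable]: "G n \<in> borel_measurable M" for n
    using distributed_measurable[OF G_normal] by simp
  define N where "N \<omega> = lim (\<lambda>n. G n \<omega>)" for \<omega>
  have N_meas[measurable]: "N \<in> borel_measurable M" unfolding N_def by measurable
  have lim: "AE \<omega> in M. (\<lambda>n. G n \<omega>) \<longlonglongrightarrow> ou (\<lambda>s. sqrt 2 * W s \<omega>) t"
    using W_continuous
  proof eventually_elim
    case (elim \<omega>)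
    show ?case unfolding G_def
      by (rule ou_sum_tendsto) (use t in \<open>auto intro!: continuous_intros continuous_on_subset[OF elim]\<close>)
  qed
  then have N_eq: "AE \<omega> in M. N \<omega> = ou (\<lambda>s. sqrt 2 * W s \<omega>) t"
    by eventually_elim (simp add: N_def limI)
  have N_lim: "AE \<omega> in M. (\<lambda>n. G n \<omega>) \<longlonglongrightarrow> N \<omega>"
    using lim N_eq by eventually_elim simp

  have char_G: "char (distr M borel (G n)) u = exp (- ((u * sqrt (v n))\<^sup>2) / 2)" for n u
  proof -
    have "distributed M lborel (\<lambda>\<omega>. (G n \<omega> - 0) / sqrt (v n)) std_normal_density"
      using normal_standard_normal_convert[of "sqrt (v n)" "G n" 0] v_pos[of n] G_normal[of n] by simp
    then have "distr M lborel (\<lambda>\<omega>. (G n \<omega> - 0) / sqrt (v n)) = std_normal_distribution"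
      by (rule distributed_distr_eq_density)
    then have std: "distr M borel (\<lambda>\<omega>. G n \<omega> / sqrt (v n)) = std_normal_distribution"
      by (simp cong: distr_cong)
    have "char (distr M borel (G n)) u = (CLINT \<omega>|M. iexp (u * G n \<omega>))"
      unfolding char_def by (intro integral_distr) auto
    also have "\<dots> = (CLINT \<omega>|M. iexp ((u * sqrt (v n)) * (G n \<omega> / sqrt (v n))))"
      using v_pos[of n] by (intro Bochner_Integration.integral_cong) auto
    also have "\<dots> = char (distr M borel (\<lambda>\<omega>. G n \<omega> / sqrt (v n))) (u * sqrt (v n))"
      unfolding char_def by (intro integral_distr[symmetric]) auto
    finally show ?thesis unfolding std char_std_normal_distribution by simp
  qed
  have char_N: "char (distr M borel N) u = exp (- ((u * \<sigma>)\<^sup>2) / 2)" for u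
  proof (rule LIMSEQ_unique)
    show "(\<lambda>n. char (distr M borel (G n)) u) \<longlonglongrightarrow> char (distr M borel N) u"
    proof -
      have "(\<lambda>n. CLINT \<omega>|M. iexp (u * G n \<omega>)) \<longlonglongrightarrow> (CLINT \<omega>|M. iexp (u * N \<omega>))"
      proof (rule integral_dominated_convergence[where w = "\<lambda>_. 1"])
        show "AE \<omega> in M. (\<lambda>n. iexp (u * G n \<omega>)) \<longlonglongrightarrow> iexp (u * N \<omega>)"
          using N_lim by eventually_elim (intro tendsto_intros)
      qed auto
      then show ?thesis unfolding char_def by (subst (1 2) integral_distr) auto
    qed
    show "(\<lambda>n. char (distr M borel (G n)) u) \<longlonglongrightarrow> exp (- ((u * \<sigma>)\<^sup>2) / 2)"
      unfolding char_G by (intro tendsto_intros v_lim) auto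
  qed
  interpret S: real_distribution std_normal_distribution by (rule real_dist_normal_dist)
  have "distr M borel N = distr std_normal_distribution borel (\<lambda>x. \<sigma> * x)"
  proof (rule Levy_uniqueness)
    show "real_distribution (distr M borel N)" by (rule real_distribution_distr) simp
    show "real_distribution (distr std_normal_distribution borel (\<lambda>x. \<sigma> * x))"
      by (rule S.real_distribution_distr) simp
    show "char (distr M borel N) = char (distr std_normal_distribution borel (\<lambda>x. \<sigma> * x))"
    proof
      fix u
      have "char (distr std_normal_distribution borel (\<lambda>x. \<sigma> * x)) u
          = (CLINT x|std_normal_distribution. iexp (u * (\<sigma> * x)))"
        unfolding char_def by (intro integral_distr) auto
      also have "\<dots> = char std_normal_distribution (u * \<sigma>)" unfolding char_def by (simp add: mult.assoc)
      finally show "char (distr M borel N) u = char (distr std_normal_distribution borel (\<lambda>x. \<sigma> * x)) u"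
        unfolding char_N char_std_normal_distribution by simp
    qed
  qed
  note N_distr = this
  have "prob {\<omega>\<in>space M. N \<omega> \<le> y} = cdf std_normal_distribution (y / \<sigma>)" for y
  proof -
    have "prob {\<omega>\<in>space M. N \<omega> \<le> y} = measure (distr M borel N) {..y}"
      by (subst measure_distr) (auto intro!: arg_cong[where f = prob])
    also have "\<dots> = measure std_normal_distribution {x. \<sigma> * x \<le> y}"
      unfolding N_distr by (subst measure_distr) (auto simp: vimage_def)
    also have "{x. \<sigma> * x \<le> y} = {..y / \<sigma>}" using \<sigma> by (auto simp: field_simps)
    finally show ?thesis by (simp add: cdf_def)
  qed
  then show ?thesis using that[OF N_meas N_eq] by (simp only: \<sigma>_def)
qed

end

section \<open>Convergence to the normal distribution\<close>

lemma isCont_cdf_std_normal: "isCont (cdf std_normal_distribution) x"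
proof -
  interpret S: real_distribution std_normal_distribution by (rule real_dist_normal_dist)
  have "absolutely_continuous lborel std_normal_distribution"
    by (rule absolutely_continuousI_density) simp
  then have "{x} \<in> null_sets std_normal_distribution"
    using finite_imp_null_set_lborel[of "{x}"] by (auto simp: absolutely_continuous_def)
  then show ?thesis by (simp add: S.isCont_cdf measure_def null_setsD1)
qed

lemma cdf_std_normal_tendsto:
  assumes "(f \<longlongrightarrow> x) F"
  shows "((\<lambda>t. cdf std_normal_distribution (f t)) \<longlongrightarrow> cdf std_normal_distribution x) F"
  by (rule isCont_tendsto_compose[OF isCont_cdf_std_normal assms])

context stationary_diffusion
begin

lemma Q_component_measurable[measurable]:
  "0 \<le> t \<Longrightarrow> Q1 t \<in> borel_measurable M" "0 \<le> t \<Longrightarrow> Q2 t \<in> borel_measurable M"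
  by (rule Q1_measurable Q2_measurable; assumption)+

abbreviation centred_cdf :: "real \<Rightarrow> real" where
  "centred_cdf x \<equiv> cdf (distr \<pi> borel (\<lambda>(q1, q2). q1 + \<beta>)) x"

lemma centred_cdf_eq:
  assumes t: "0 \<le> t"
  shows "centred_cdf x = prob {\<omega>\<in>space M. Q1 t \<omega> + \<beta> \<le> x}"
proof -
  have [measurable]: "(\<lambda>y::real \<times> real. fst y + \<beta>) \<in> borel_measurable borel"
    by (intro borel_measurable_continuous_onI continuous_intros)
  have "centred_cdf x = measure (distr (distr M borel (\<lambda>\<omega>. (Q1 t \<omega>, Q2 t \<omega>))) borel (\<lambda>y. fst y + \<beta>)) {..x}"
    by (simp add: cdf_def law[OF t] case_prod_beta')
  also have "distr (distr M borel (\<lambda>\<omega>. (Q1 t \<omega>, Q2 t \<omega>))) borel (\<lambda>y. fst y + \<beta>)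
      = distr M borel (\<lambda>\<omega>. Q1 t \<omega> + \<beta>)"
    using t by (subst distr_distr) (auto simp: comp_def)
  also have "measure \<dots> {..x} = prob {\<omega>\<in>space M. Q1 t \<omega> + \<beta> \<le> x}"
    using t by (subst measure_distr) (auto intro!: arg_cong[where f = prob])
  finally show ?thesis .
qed

text \<open>
  The time \<open>t = \<beta>\<close> balances the two error terms of \<open>q1_upper\<close>: the initial condition contributes at
  most $e^{-\beta} \beta$, and \<open>Q2\<close> is multiplied only by \<open>\<beta> + 1\<close>, which its tail bound of order
  $\beta^{-3}$ compensates.
\<close>

lemma centred_cdf_ge:
  assumes \<epsilon>: "0 < \<epsilon>" and small: "exp (- \<beta>) * \<beta> \<le> \<epsilon>"
  shows "cdf std_normal_distribution ((x - 2 * \<epsilon>) / sqrt (1 - exp (- 2 * \<beta>))) - q2_tail_bound \<beta> (\<epsilon> / (\<beta> + 1))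
    \<le> centred_cdf x"
proof -
  obtain N where [measurable]: "N \<in> borel_measurable M"
    and N: "AE \<omega> in M. N \<omega> = ou (\<lambda>s. sqrt 2 * W s \<omega>) \<beta>"
      "\<And>y. prob {\<omega>\<in>space M. N \<omega> \<le> y} = cdf std_normal_distribution (y / sqrt (1 - exp (- 2 * \<beta>)))"
    using ou_law[OF \<beta>_pos] by blast
  have \<beta>0[simp]: "0 \<le> \<beta>" using \<beta>_pos by simp
  define B where "B = {\<omega>\<in>space M. Q1 \<beta> \<omega> + \<beta> \<le> x}"
  define C where "C = {\<omega>\<in>space M. \<epsilon> / (\<beta> + 1) < Q2 \<beta> \<omega>}"
  have [measurable]: "B \<in> sets M" "C \<in> sets M" unfolding B_def C_def by measurable
  have "prob {\<omega>\<in>space M. N \<omega> \<le> x - 2 * \<epsilon>} \<le> prob (B \<union> C)"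
  proof (rule finite_measure_mono_AE)
    show "AE \<omega> in M. \<omega> \<in> {\<omega>\<in>space M. N \<omega> \<le> x - 2 * \<epsilon>} \<longrightarrow> \<omega> \<in> B \<union> C"
      using N(1) AE_reflected_path[OF \<beta>_pos]
    proof eventually_elim
      case (elim \<omega>)
      interpret reflected_path \<beta> "\<lambda>t. sqrt 2 * W t \<omega>" "\<lambda>t. Q1 t \<omega>" "\<lambda>t. Q2 t \<omega>" "\<lambda>t. L t \<omega>"
        by (rule elim(2))
      show ?case
      proof (safe, goal_cases)
        case 1
        then have "Q2 \<beta> \<omega> \<le> \<epsilon> / (\<beta> + 1)" by (simp add: C_def)
        then have "(\<beta> + 1) * Q2 \<beta> \<omega> \<le> \<epsilon>" using \<beta>_pos by (simp add: field_simps)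
        then have "Q1 \<beta> \<omega> + \<beta> \<le> x" using q1_upper[OF \<beta>0] elim(1) 1 small by simp
        then show ?case using 1 by (simp add: B_def)
      qed
    qed
  qed measurable
  also have "\<dots> \<le> prob B + prob C" by (rule measure_Un_le) auto
  also have "prob C \<le> q2_tail_bound \<beta> (\<epsilon> / (\<beta> + 1))"
    unfolding C_def using \<beta>_pos \<epsilon> by (intro Q2_tail) auto
  finally show ?thesis unfolding N(2) centred_cdf_eq[OF \<beta>0] B_def by simp
qed

text \<open>
  In \<open>q1_lower\<close> the factor in front of \<open>Q2\<close> does not grow with \<open>t\<close>. So \<open>t\<close> can tend to infinity for
  fixed \<open>\<beta>\<close>, which removes the initial condition without any control of how its law depends on \<open>\<beta>\<close>.
  The events \<open>D n\<close> say that the initial condition still matters at time \<open>n + 1\<close>.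
\<close>

lemma centred_cdf_le:
  assumes \<epsilon>: "0 < \<epsilon>"
  shows "centred_cdf x \<le> cdf std_normal_distribution (x + 2 * \<epsilon>) + q2_tail_bound \<beta> \<epsilon>"
proof -
  define Y where "Y \<omega> = \<bar>Q1 0 \<omega> + Q2 0 \<omega> + \<beta>\<bar>" for \<omega>
  have [measurable]: "Y \<in> borel_measurable M" unfolding Y_def by measurable
  define D where "D n = {\<omega>\<in>space M. \<epsilon> * exp (real (Suc n)) \<le> Y \<omega>}" for n
  have D_sets[measurable]: "D n \<in> sets M" for n unfolding D_def by measurable
  have bound: "centred_cdf x \<le> cdf std_normal_distribution ((x + 2 * \<epsilon>) / sqrt (1 - exp (- 2 * real (Suc n))))
      + q2_tail_bound \<beta> \<epsilon> + prob (D n)" for n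
  proof -
    define t where "t = real (Suc n)"
    have t: "0 < t" "0 \<le> t" by (simp_all add: t_def)
    obtain N where [measurable]: "N \<in> borel_measurable M"
      and N: "AE \<omega> in M. N \<omega> = ou (\<lambda>s. sqrt 2 * W s \<omega>) t"
        "\<And>y. prob {\<omega>\<in>space M. N \<omega> \<le> y} = cdf std_normal_distribution (y / sqrt (1 - exp (- 2 * t)))"
      using ou_law[OF t(1)] by blast
    define B where "B = {\<omega>\<in>space M. N \<omega> \<le> x + 2 * \<epsilon>}"
    define C where "C = {\<omega>\<in>space M. \<epsilon> < Q2 t \<omega>}"
    have [measurable]: "B \<in> sets M" "C \<in> sets M" unfolding B_def C_def using t(2) by measurable
    have "prob {\<omega>\<in>space M. Q1 t \<omega> + \<beta> \<le> x} \<le> prob (B \<union> C \<union> D n)"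
    proof (rule finite_measure_mono_AE)
      show "AE \<omega> in M. \<omega> \<in> {\<omega>\<in>space M. Q1 t \<omega> + \<beta> \<le> x} \<longrightarrow> \<omega> \<in> B \<union> C \<union> D n"
        using N(1) AE_reflected_path[OF \<beta>_pos]
      proof eventually_elim
        case (elim \<omega>)
        interpret reflected_path \<beta> "\<lambda>t. sqrt 2 * W t \<omega>" "\<lambda>t. Q1 t \<omega>" "\<lambda>t. Q2 t \<omega>" "\<lambda>t. L t \<omega>"
          by (rule elim(2))
        show ?case
        proof (safe, goal_cases)
          case 1
          then have Q2: "Q2 t \<omega> \<le> \<epsilon>" by (simp add: C_def)
          have "Y \<omega> \<le> \<epsilon> * exp t" using 1 by (simp add: D_def t_def)
          then have "exp (- t) * Y \<omega> \<le> exp (- t) * (\<epsilon> * exp t)" by (intro mult_left_mono) auto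
          also have "\<dots> = \<epsilon>" by (simp add: exp_minus)
          finally have "exp (- t) * Y \<omega> \<le> \<epsilon>" .
          moreover have "exp (- t) * (- Y \<omega>) \<le> exp (- t) * (Q1 0 \<omega> + Q2 0 \<omega> + \<beta>)"
            by (intro mult_left_mono) (auto simp: Y_def)
          ultimately have "N \<omega> \<le> x + 2 * \<epsilon>" using q1_lower[OF t(2)] elim(1) 1 Q2 by simp
          then show ?case using 1 by (simp add: B_def)
        qed
      qed
    qed measurable
    also have "\<dots> \<le> prob (B \<union> C) + prob (D n)" by (rule measure_Un_le) auto
    also have "prob (B \<union> C) \<le> prob B + prob C" by (rule measure_Un_le) auto
    also have "prob C \<le> q2_tail_bound \<beta> \<epsilon>"
      unfolding C_def using t \<epsilon> by (intro Q2_tail) auto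
    finally show ?thesis unfolding B_def N(2) centred_cdf_eq[OF t(2), symmetric] by (simp add: t_def)
  qed
  have "(\<lambda>n. prob (D n)) \<longlonglongrightarrow> prob (\<Inter>n. D n)"
  proof (rule finite_Lim_measure_decseq)
    show "decseq D"
      unfolding decseq_def D_def using \<epsilon> by (auto elim!: order_trans[rotated])
  qed auto
  moreover have "(\<Inter>n. D n) = {}"
  proof -
    have "\<exists>n. \<omega> \<notin> D n" for \<omega>
    proof -
      obtain n :: nat where n: "Y \<omega> / \<epsilon> < real n" using reals_Archimedean2 by blast
      have "real n \<le> exp (real (Suc n))" using exp_ge_add_one_self[of "real (Suc n)"] by simp
      then have "Y \<omega> / \<epsilon> < exp (real (Suc n))" using n by linarith
      then show ?thesis using \<epsilon> by (intro exI[of _ n]) (simp add: D_def field_simps)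
    qed
    then show ?thesis by blast
  qed
  ultimately have D_lim: "(\<lambda>n. prob (D n)) \<longlonglongrightarrow> 0" by simp
  have "filterlim (\<lambda>n. real (Suc n)) at_top sequentially"
    by (rule filterlim_compose[OF filterlim_real_sequentially filterlim_Suc])
  then have "filterlim (\<lambda>n. 2 * real (Suc n)) at_top sequentially"
    by (intro filterlim_tendsto_pos_mult_at_top[OF tendsto_const]) auto
  then have "(\<lambda>n. exp (- (2 * real (Suc n)))) \<longlonglongrightarrow> 0"
    by (intro filterlim_compose[OF exp_at_bot] filterlim_compose[OF filterlim_uminus_at_bot_at_top])
  then have "(\<lambda>n. (x + 2 * \<epsilon>) / sqrt (1 - exp (- (2 * real (Suc n))))) \<longlonglongrightarrow> (x + 2 * \<epsilon>) / sqrt (1 - 0)"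
    by (intro tendsto_intros) auto
  then have "(\<lambda>n. (x + 2 * \<epsilon>) / sqrt (1 - exp (- 2 * real (Suc n)))) \<longlonglongrightarrow> x + 2 * \<epsilon>"
    by simp
  then have "(\<lambda>n. cdf std_normal_distribution ((x + 2 * \<epsilon>) / sqrt (1 - exp (- 2 * real (Suc n))))
      + q2_tail_bound \<beta> \<epsilon> + prob (D n)) \<longlonglongrightarrow> cdf std_normal_distribution (x + 2 * \<epsilon>) + q2_tail_bound \<beta> \<epsilon> + 0"
    by (intro tendsto_intros cdf_std_normal_tendsto D_lim)
  from LIMSEQ_le_const[OF this] bound show ?thesis by auto
qed

end

lemma stationary_distribution_cases:
  fixes \<pi> :: "(real \<times> real) measure"
  assumes "stationary_distribution TYPE('a) \<beta> \<pi>" "0 < \<beta>"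
  obtains M :: "'a measure" and W Q1 Q2 L where "stationary_diffusion M W \<beta> Q1 Q2 L \<pi>"
  using assms unfolding stationary_distribution_def stationary_diffusion_def stationary_diffusion_axioms_def
  by blast

theorem theorem2p4:
  fixes \<pi> :: "real \<Rightarrow> (real \<times> real) measure"
  assumes stationary: "\<And>\<beta>. 0 < \<beta> \<Longrightarrow> stationary_distribution TYPE('a) \<beta> (\<pi> \<beta>)"
  shows "weak_conv_along (\<lambda>\<beta>. distr (\<pi> \<beta>) borel (\<lambda>(q1, q2). q1 + \<beta>))
           std_normal_distribution at_top"
  unfolding weak_conv_along_def
proof (intro allI impI)
  fix x :: real
  let ?\<Phi> = "cdf std_normal_distribution"
  let ?F = "\<lambda>\<beta>. cdf (distr (\<pi> \<beta>) borel (\<lambda>(q1, q2). q1 + \<beta>)) x"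
  have upper: "?F \<beta> \<le> ?\<Phi> (x + 2 * \<epsilon>) + q2_tail_bound \<beta> \<epsilon>" if \<beta>: "0 < \<beta>" and \<epsilon>: "0 < \<epsilon>" for \<beta> \<epsilon>
  proof -
    obtain M :: "'a measure" and W Q1 Q2 L where "stationary_diffusion M W \<beta> Q1 Q2 L (\<pi> \<beta>)"
      using stationary_distribution_cases[OF stationary[OF \<beta>] \<beta>] .
    then interpret stationary_diffusion M W \<beta> Q1 Q2 L "\<pi> \<beta>" .
    show ?thesis by (rule centred_cdf_le[OF \<epsilon>])
  qed
  have lower: "?\<Phi> ((x - 2 * \<epsilon>) / sqrt (1 - exp (- 2 * \<beta>))) - q2_tail_bound \<beta> (\<epsilon> / (\<beta> + 1)) \<le> ?F \<beta>"
    if \<beta>: "0 < \<beta>" and \<epsilon>: "0 < \<epsilon>" "exp (- \<beta>) * \<beta> \<le> \<epsilon>" for \<beta> \<epsilon>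
  proof -
    obtain M :: "'a measure" and W Q1 Q2 L where "stationary_diffusion M W \<beta> Q1 Q2 L (\<pi> \<beta>)"
      using stationary_distribution_cases[OF stationary[OF \<beta>] \<beta>] .
    then interpret stationary_diffusion M W \<beta> Q1 Q2 L "\<pi> \<beta>" .
    show ?thesis by (rule centred_cdf_ge[OF \<epsilon>])
  qed
  have \<Phi>_near: "((\<lambda>\<epsilon>. ?\<Phi> (x + c * \<epsilon>)) \<longlongrightarrow> ?\<Phi> x) (at_right 0)" for c
  proof -
    have "((\<lambda>\<epsilon>. x + c * \<epsilon>) \<longlongrightarrow> x + c * 0) (at_right 0)" by (intro tendsto_intros)
    then show ?thesis by (intro cdf_std_normal_tendsto) simp
  qed
  show "(?F \<longlongrightarrow> ?\<Phi> x) at_top"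
  proof (rule order_tendstoI)
    fix y assume "?\<Phi> x < y"
    then have "\<forall>\<^sub>F \<epsilon> in at_right 0. ?\<Phi> (x + 2 * \<epsilon>) < y \<and> 0 < \<epsilon>"
      using order_tendstoD(2)[OF \<Phi>_near] by (intro eventually_conj eventually_at_right_less) auto
    then obtain \<epsilon> where \<epsilon>: "?\<Phi> (x + 2 * \<epsilon>) < y" "0 < \<epsilon>"
      using eventually_happens'[OF trivial_limit_at_right_real] by blast
    have "((\<lambda>\<beta>. q2_tail_bound \<beta> \<epsilon>) \<longlongrightarrow> 0) at_top" unfolding q2_tail_bound_def noise_cost_def using \<epsilon>(2) by real_asymp
    then have "((\<lambda>\<beta>. ?\<Phi> (x + 2 * \<epsilon>) + q2_tail_bound \<beta> \<epsilon>) \<longlongrightarrow> ?\<Phi> (x + 2 * \<epsilon>) + 0) at_top"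
      by (intro tendsto_intros)
    then have "\<forall>\<^sub>F \<beta> in at_top. ?\<Phi> (x + 2 * \<epsilon>) + q2_tail_bound \<beta> \<epsilon> < y"
      using \<epsilon>(1) by (intro order_tendstoD) auto
    then show "\<forall>\<^sub>F \<beta> in at_top. ?F \<beta> < y"
      using eventually_gt_at_top[of 0]
    proof eventually_elim
      case (elim \<beta>)
      then show ?case using upper[OF elim(2) \<epsilon>(2)] by linarith
    qed
  next
    fix y assume "y < ?\<Phi> x"
    then have "\<forall>\<^sub>F \<epsilon> in at_right 0. y < ?\<Phi> (x + (- 2) * \<epsilon>) \<and> 0 < \<epsilon>"
      using order_tendstoD(1)[OF \<Phi>_near[of "- 2"]] by (intro eventually_conj eventually_at_right_less) auto
    then obtain \<epsilon> where \<epsilon>: "y < ?\<Phi> (x - 2 * \<epsilon>)" "0 < \<epsilon>"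
      using eventually_happens'[OF trivial_limit_at_right_real] by fastforce
    have "((\<lambda>\<beta>. q2_tail_bound \<beta> (\<epsilon> / (\<beta> + 1))) \<longlongrightarrow> 0) at_top" unfolding q2_tail_bound_def noise_cost_def using \<epsilon>(2) by real_asymp
    moreover have "((\<lambda>\<beta>. (x - 2 * \<epsilon>) / sqrt (1 - exp (- 2 * \<beta>))) \<longlongrightarrow> x - 2 * \<epsilon>) at_top"
      by real_asymp
    ultimately have "((\<lambda>\<beta>. ?\<Phi> ((x - 2 * \<epsilon>) / sqrt (1 - exp (- 2 * \<beta>))) - q2_tail_bound \<beta> (\<epsilon> / (\<beta> + 1)))
        \<longlongrightarrow> ?\<Phi> (x - 2 * \<epsilon>) - 0) at_top"
      by (intro tendsto_intros cdf_std_normal_tendsto)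
    then have "\<forall>\<^sub>F \<beta> in at_top. y < ?\<Phi> ((x - 2 * \<epsilon>) / sqrt (1 - exp (- 2 * \<beta>))) - q2_tail_bound \<beta> (\<epsilon> / (\<beta> + 1))"
      using \<epsilon>(1) by (intro order_tendstoD) auto
    moreover have "\<forall>\<^sub>F \<beta>::real in at_top. exp (- \<beta>) * \<beta> \<le> \<epsilon>"
    proof -
      have "((\<lambda>\<beta>::real. exp (- \<beta>) * \<beta>) \<longlongrightarrow> 0) at_top" by real_asymp
      from order_tendstoD(2)[OF this \<epsilon>(2)] show ?thesis by (auto elim: eventually_mono)
    qed
    ultimately show "\<forall>\<^sub>F \<beta> in at_top. y < ?F \<beta>"
      using eventually_gt_at_top[of 0]
    proof eventually_elim
      case (elim \<beta>)
      then show ?case using lower[OF elim(3) \<epsilon>(2) elim(2)] by linarith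
    qed
  qed
qed

end
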